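(* Let $1\le k\le d$ be integers, and let $u_1,\dots,u_{k-1}\in\mathbb{R}^d$ be arbitrary vectors. Given $d+1$ mass assignments $\mu_0,\dots,\mu_d$ on the $k$-dimensional linear subspaces of $\mathbb{R}^d$, there exist a $k$-dimensional linear subspace $L$ of $\mathbb{R}^d$ containing $u_1,\dots,u_{k-1}$ and a sphere $\Sigma$ in $L$ (possibly degenerate, i.e. a hyperplane of $L$) such that the closed region of $L$ bounded by $\Sigma$ (the closed ball, or a closed half-space in the degenerate case) contains exactly half of each of the mass distributions $\mu_0^L,\dots,\mu_d^L$. *)

theory Defs
  imports "HOL-Analysis.Analysis"
begin

definition grassmannian :: "nat \<Rightarrow> ('a::euclidean_space) set set" where
  "grassmannian k = {L. subspace L \<and> dim L = k}"

text \<open>Standard metric on the Grassmannian: Hausdorff distance of the unit balls.\<close>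
definition gr_dist :: "('a::euclidean_space) set \<Rightarrow> 'a set \<Rightarrow> real" where
  "gr_dist L M = max (SUP x \<in> L \<inter> cball 0 1. infdist x (M \<inter> cball 0 1))
                     (SUP y \<in> M \<inter> cball 0 1. infdist y (L \<inter> cball 0 1))"

text \<open>Lebesgue measure on a k-dimensional subspace L, transported from R^k (= real^'k, with
  k = CARD('k)) along a linear bijection g onto L.  A mass distribution on L is a finite Borel
  measure on the ambient space that is absolutely continuous with respect to it (in particular
  it is concentrated on L).  The notion does not depend on the choice of g.\<close>
definition mass_distribution_on ::
  "'k::finite itself \<Rightarrow> (real^'n) set \<Rightarrow> (real^'n) measure \<Rightarrow> bool" where
  "mass_distribution_on _ L m \<longleftrightarrow>
     sets m = sets borel \<and> finite_measure m \<and>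
     (\<forall>g :: real^'k \<Rightarrow> real^'n. linear g \<and> inj g \<and> range g = L \<longrightarrow>
        absolutely_continuous (distr lborel borel g) m)"

definition mass_assignment ::
  "'k::finite itself \<Rightarrow> ((real^'n) set \<Rightarrow> (real^'n) measure) \<Rightarrow> bool" where
  "mass_assignment K \<mu> \<longleftrightarrow>
     (\<forall>L \<in> grassmannian CARD('k). mass_distribution_on K L (\<mu> L)) \<and>
     (\<forall>f :: real^'n \<Rightarrow> real. continuous_on UNIV f \<and> bounded (range f) \<longrightarrow>
        (\<forall>L \<in> grassmannian CARD('k). \<forall>e>0. \<exists>\<delta>>0. \<forall>M \<in> grassmannian CARD('k).
            gr_dist M L < \<delta> \<longrightarrow>
            \<bar>(\<integral>x. f x \<partial>(\<mu> M)) - (\<integral>x. f x \<partial>(\<mu> L))\<bar> < e))"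

definition sphere_regions :: "(real^'n) set \<Rightarrow> (real^'n) set set" where
  "sphere_regions L =
     {L \<inter> cball c r | c r. c \<in> L \<and> r > 0} \<union>
     {{x \<in> L. a \<bullet> x \<le> b} | a b. a \<in> L \<and> a \<noteq> 0}"

end

theory Submission
  imports Defs "HOL-Library.Z2"
begin

text \<open>
  Let V be a (k-1)-dimensional subspace containing the given vectors and T its orthogonal complement,
  of dimension a = d-k+1. A point (v, y) of the boundary of the cube in T times the cube in V x R x R,
  y = (y', b, c), determines the subspace L = V + R v and the function
  q(x) = s (v . x) + y' . x + b + c |x|^2 on L, where s >= 0 vanishes exactly when y is on the boundary
  of its cube. The zero set of q is a sphere or a hyperplane of L, and F_r(v, y), the integral of
  sgn q against the r-th mass on L, vanishes iff the r-th mass is halved. The d+1 functions F_r are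
  continuous and odd, and F_r(-v, y) = F_r(v, y) for boundary points y, because then q does not depend
  on v. Such functions have a common zero; this is a form of the Borsuk-Ulam theorem for the sphere
  bundle of (tautological line bundle plus a trivial bundle) over a projective space.

  The common zero comes from a mod 2 count on a fine cubical grid. If the signs g_0, g_1, ... are
  odd functions on the cells, then w_0 = 1, w_(r+1) = coboundary of g_r w_r are cocycles invariant
  under the antipodal map: w_r represents the r-th power of the characteristic class of the double
  cover. Evaluating them on an increasing sequence of half-boxes by Stokes' formula shows that the top
  cocycle is nonzero on some cell, which yields a chain of cells along which each g_r changes sign.
\<close>

section \<open>Cubical cochains mod 2\<close>

text \<open>As simp rules these turn sums and products into bit operations; without them the
  simplifier stays in ring arithmetic.\<close>

declare add_bit_eq_xor [simp del] mult_bit_eq_and [simp del]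

lemma bit_add_self [simp]: "(a::bit) + a = 0" "a + (a + b) = (b::bit)"
  by (cases a; cases b; simp)+

section \<open>Cancellation of sums mod 2\<close>

text \<open>Off the diagonal the terms come in equal pairs. This cancellation is behind both
  \<open>cobd_cobd\<close> and \<open>bd_sphere_chain\<close>.\<close>

lemma sum_symmetric_bit:
  fixes S :: "'a \<Rightarrow> 'a \<Rightarrow> bit"
  assumes "finite A" "\<And>i j. i \<in> A \<Longrightarrow> j \<in> A \<Longrightarrow> S i j = S j i" "\<And>i. i \<in> A \<Longrightarrow> S i i = 0"
  shows "(\<Sum>i\<in>A. \<Sum>j\<in>A. S i j) = 0"
  using assms
proof (induction A rule: finite_induct)
  case (insert x A)
  have "(\<Sum>i\<in>A. S i x) = (\<Sum>j\<in>A. S x j)"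
    using insert.prems by (intro sum.cong) auto
  then show ?case
    using insert by (simp add: sum.distrib)
qed simp

text \<open>All orbits have exactly two elements, whose equal values cancel; the induction removes
  one orbit at a time.\<close>

lemma sum_involution_bit:
  fixes f :: "'a \<Rightarrow> bit"
  assumes "finite A" "\<And>x. x \<in> A \<Longrightarrow> \<sigma> x \<in> A \<and> \<sigma> x \<noteq> x \<and> \<sigma> (\<sigma> x) = x \<and> f (\<sigma> x) = f x"
  shows "sum f A = 0"
  using assms
proof (induction "card A" arbitrary: A rule: less_induct)
  case less
  show ?case
  proof (cases "A = {}")
    case False
    then obtain x where x: "x \<in> A" by auto
    let ?B = "A - {x} - {\<sigma> x}"
    have "?B \<subset> A" using x by auto
    then have "card ?B < card A" by (rule psubset_card_mono[OF less.prems(1)])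
    moreover have "\<sigma> y \<in> ?B \<and> \<sigma> y \<noteq> y \<and> \<sigma> (\<sigma> y) = y \<and> f (\<sigma> y) = f y" if "y \<in> ?B" for y
      using less.prems(2)[of y] less.prems(2)[of x] x that by (metis Diff_iff singleton_iff)
    ultimately have "sum f ?B = 0" using less.prems(1) by (intro less.hyps) auto
    moreover have "sum f A = f x + (f (\<sigma> x) + sum f ?B)"
      using less.prems x by (metis (no_types, lifting) Diff_iff finite_Diff singletonD sum.remove)
    ultimately show ?thesis using less.prems(2)[OF x] by simp
  qed simp
qed

section \<open>Boundary and coboundary on the cubical grid\<close>

text \<open>An integer vector encodes a cell of the cubical grid of mesh 2: an odd coordinate t stands for the
  open interval (t-1, t+1), an even one for a point. Cochains take values in the field with two elements.\<close>

definition bd :: "nat \<Rightarrow> ((nat \<Rightarrow> int) \<Rightarrow> bit) \<Rightarrow> (nat \<Rightarrow> int) \<Rightarrow> bit" where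
  "bd D X p = (\<Sum>i<D. if even (p i) then X (p(i := p i + 1)) + X (p(i := p i - 1)) else 0)"

definition cobd :: "nat \<Rightarrow> ((nat \<Rightarrow> int) \<Rightarrow> bit) \<Rightarrow> (nat \<Rightarrow> int) \<Rightarrow> bit" where
  "cobd D F q = (\<Sum>i<D. if odd (q i) then F (q(i := q i + 1)) + F (q(i := q i - 1)) else 0)"

text \<open>For two distinct odd coordinates the order of passing to faces does not matter, so the
  double sum is symmetric. A coordinate used once has become even, so the diagonal vanishes.\<close>

lemma cobd_cobd: "cobd D (cobd D F) q = 0"
proof -
  define S where "S i j = (if odd (q i) then
      (if odd ((q(i := q i + 1)) j) then F (q(i := q i + 1, j := (q(i := q i + 1)) j + 1))
         + F (q(i := q i + 1, j := (q(i := q i + 1)) j - 1)) else 0) +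
      (if odd ((q(i := q i - 1)) j) then F (q(i := q i - 1, j := (q(i := q i - 1)) j + 1))
         + F (q(i := q i - 1, j := (q(i := q i - 1)) j - 1)) else 0) else 0)" for i j
  have "cobd D (cobd D F) q = (\<Sum>i<D. \<Sum>j<D. S i j)"
    unfolding cobd_def S_def by (intro sum.cong refl) (simp add: sum.distrib)
  also have "\<dots> = 0"
  proof (rule sum_symmetric_bit)
    show "S i j = S j i" for i j
    proof (cases "i = j")
      case False
      then show ?thesis
        by (auto simp: S_def fun_upd_twist[OF False] ac_simps)
    qed simp
  qed (auto simp: S_def)
  finally show ?thesis .
qed

lemma cobd_add: "cobd D (\<lambda>p. F p + G p) q = cobd D F q + cobd D G q"
  unfolding cobd_def by (subst sum.distrib[symmetric]) (intro sum.cong, auto simp: ac_simps)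

lemma cobd_scale: "cobd D (\<lambda>p. c * F p) q = c * cobd D F q"
  unfolding cobd_def sum_distrib_left by (intro sum.cong refl) (simp add: algebra_simps)

lemma bd_add: "bd D (\<lambda>p. F p + G p) q = bd D F q + bd D G q"
  unfolding bd_def by (subst sum.distrib[symmetric]) (intro sum.cong, auto simp: ac_simps)

lemma bd_zero: "bd D (\<lambda>p. 0) q = 0"
  by (simp add: bd_def cong: if_cong)

lemma bd_sum: "finite A \<Longrightarrow> bd D (\<lambda>p. \<Sum>i\<in>A. F i p) q = (\<Sum>i\<in>A. bd D (F i) q)"
  by (induction A rule: finite_induct) (simp_all add: bd_add bd_zero)

section \<open>Coordinate reflections and the iterated cocycles\<close>

text \<open>\<open>J = UNIV\<close> gives the antipodal map; \<open>J = {..<a}\<close> reflects the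
  sphere factor only.\<close>

definition flip :: "nat set \<Rightarrow> (nat \<Rightarrow> int) \<Rightarrow> nat \<Rightarrow> int" where
  "flip J p = (\<lambda>i. if i \<in> J then - p i else p i)"

lemma flip_apply: "flip J p i = (if i \<in> J then - p i else p i)"
  by (simp add: flip_def)

lemma flip_flip [simp]: "flip J (flip J p) = p"
  by (auto simp: flip_def)

lemma abs_flip [simp]: "\<bar>flip J p i\<bar> = \<bar>p i\<bar>"
  by (auto simp: flip_def)

text \<open>A reflection preserves parity and interchanges the two faces in each reflected
  direction.\<close>

lemma cobd_flip: "cobd D (\<lambda>p. F (flip J p)) q = cobd D F (flip J q)"
proof -
  have *: "flip J (q(i := t)) = (flip J q)(i := if i \<in> J then - t else t)" for i t
    by (auto simp: flip_def fun_eq_iff)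
  have **: "- 1 - t = - t - (1::int)" for t
    by simp
  show ?thesis
    unfolding cobd_def by (intro sum.cong refl) (auto simp: * ** flip_apply ac_simps)
qed

text \<open>The cochains carry no degree: they are defined on cells of all dimensions, and a degree
  is fixed only by the dimension of the chain they are paired with.\<close>

fun weight :: "nat \<Rightarrow> (nat \<Rightarrow> (nat \<Rightarrow> int) \<Rightarrow> bit) \<Rightarrow> nat \<Rightarrow> (nat \<Rightarrow> int) \<Rightarrow> bit" where
  "weight D g 0 q = 1"
| "weight D g (Suc r) q = cobd D (\<lambda>p. g r p * weight D g r p) q"

text \<open>For the constant 1 the two faces in each direction cancel; the later stages are
  themselves coboundaries.\<close>

lemma cobd_weight: "cobd D (weight D g r) q = 0"
proof (cases r)
  case 0
  have "weight D g 0 = (\<lambda>q. 1)" by auto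
  then show ?thesis using 0 by (simp add: cobd_def cong: if_cong)
next
  case (Suc n)
  have "weight D g (Suc n) = cobd D (\<lambda>p. g n p * weight D g n p)" by auto
  then show ?thesis using Suc by (simp add: cobd_cobd)
qed

lemma cobd_cong:
  assumes "\<And>i t. i < D \<Longrightarrow> odd (q i) \<Longrightarrow> \<bar>t - q i\<bar> = 1 \<Longrightarrow> F (q(i := t)) = G (q(i := t))"
  shows "cobd D F q = cobd D G q"
  unfolding cobd_def by (intro sum.cong refl) (auto simp: assms)

text \<open>The symmetries of the signs hold only on part of the grid. This property carries them
  over to iterated coboundaries, whose value at a cell involves only faces of that cell.\<close>

definition face_closed :: "nat \<Rightarrow> (nat \<Rightarrow> int) set \<Rightarrow> bool" where
  "face_closed D K \<longleftrightarrow> (\<forall>q\<in>K. \<forall>i<D. \<forall>t. odd (q i) \<longrightarrow> \<bar>t - q i\<bar> = 1 \<longrightarrow> q(i := t) \<in> K)"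

text \<open>Replacing \<open>g r\<close> by \<open>g r + 1\<close> changes
  \<open>g r * weight D g r\<close> by the closed cochain \<open>weight D g r\<close>, which leaves
  the coboundary unchanged.\<close>

lemma weight_flip_antisym:
  assumes "face_closed D K"
    and g: "\<And>r p. p \<in> K \<Longrightarrow> g r (flip J p) = g r p + 1"
  shows "q \<in> K \<Longrightarrow> weight D g r (flip J q) = weight D g r q"
proof (induction r arbitrary: q)
  case (Suc r)
  have K: "q(i := t) \<in> K" if "i < D" "odd (q i)" "\<bar>t - q i\<bar> = 1" for i t
    using assms(1) Suc.prems that by (auto simp: face_closed_def)
  have "weight D g (Suc r) (flip J q) = cobd D (\<lambda>p. g r (flip J p) * weight D g r (flip J p)) q"
    by (simp add: cobd_flip[of D "\<lambda>p. g r p * weight D g r p" J q])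
  also have "\<dots> = cobd D (\<lambda>p. g r p * weight D g r p + weight D g r p) q"
  proof (rule cobd_cong)
    fix i t assume "i < D" "odd (q i)" "\<bar>t - q i\<bar> = 1"
    note p = K[OF this]
    have e: "weight D g r (flip J (q(i := t))) = weight D g r (q(i := t))"
      by (rule Suc.IH[OF p])
    show "g r (flip J (q(i := t))) * weight D g r (flip J (q(i := t))) =
        g r (q(i := t)) * weight D g r (q(i := t)) + weight D g r (q(i := t))"
      unfolding g[OF p] e by (simp add: algebra_simps)
  qed
  also have "\<dots> = weight D g (Suc r) q"
    by (simp add: cobd_add cobd_weight)
  finally show ?case .
qed simp

lemma weight_flip_sym:
  assumes "face_closed D K"
    and g: "\<And>r p. p \<in> K \<Longrightarrow> g r (flip J p) = g r p"
  shows "q \<in> K \<Longrightarrow> weight D g r (flip J q) = weight D g r q"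
proof (induction r arbitrary: q)
  case (Suc r)
  have K: "q(i := t) \<in> K" if "i < D" "odd (q i)" "\<bar>t - q i\<bar> = 1" for i t
    using assms(1) Suc.prems that by (auto simp: face_closed_def)
  have "weight D g (Suc r) (flip J q) = cobd D (\<lambda>p. g r (flip J p) * weight D g r (flip J p)) q"
    by (simp add: cobd_flip[of D "\<lambda>p. g r p * weight D g r p" J q])
  also have "\<dots> = cobd D (\<lambda>p. g r p * weight D g r p) q"
  proof (rule cobd_cong)
    fix i t assume "i < D" "odd (q i)" "\<bar>t - q i\<bar> = 1"
    note p = K[OF this]
    have e: "weight D g r (flip J (q(i := t))) = weight D g r (q(i := t))"
      by (rule Suc.IH[OF p])
    show "g r (flip J (q(i := t))) * weight D g r (flip J (q(i := t))) =
        g r (q(i := t)) * weight D g r (q(i := t))"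
      unfolding g[OF p] e ..
  qed
  finally show ?case by simp
qed simp

text \<open>Since \<open>weight D g N\<close> is closed, the constant \<open>g N q\<close> may be
  added to \<open>g N\<close> before taking the coboundary at \<open>q\<close>. A nonzero value then
  forces a face with a different sign and nonzero previous weight; descending through the stages
  gives the chain.\<close>

lemma weight_chain:
  assumes K: "face_closed D K"
  shows "q \<in> K \<Longrightarrow> weight D g N q \<noteq> 0 \<Longrightarrow> \<exists>c. c N = q \<and> (\<forall>r\<le>N. c r \<in> K) \<and>
     (\<forall>r<N. g r (c r) \<noteq> g r (c (Suc r)) \<and> (\<forall>i. \<bar>c (Suc r) i - c r i\<bar> \<le> 1))"
proof (induction N arbitrary: q)
  case 0
  then show ?case by (intro exI[of _ "\<lambda>_. q"]) auto
next
  case (Suc N)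
  have "cobd D (\<lambda>p. (g N p + g N q) * weight D g N p) q
      = cobd D (\<lambda>p. g N p * weight D g N p + g N q * weight D g N p) q"
    by (simp add: algebra_simps)
  also have "\<dots> = weight D g (Suc N) q"
    by (simp add: cobd_add cobd_scale cobd_weight)
  finally have "cobd D (\<lambda>p. (g N p + g N q) * weight D g N p) q \<noteq> 0"
    using Suc.prems by simp
  moreover have "cobd D (\<lambda>_. 0) q = 0"
    by (simp add: cobd_def cong: if_cong)
  ultimately obtain i t where it: "i < D" "odd (q i)" "\<bar>t - q i\<bar> = 1"
     "(g N (q(i := t)) + g N q) * weight D g N (q(i := t)) \<noteq> 0"
    using cobd_cong[of D q "\<lambda>p. (g N p + g N q) * weight D g N p" "\<lambda>_. 0"] by metis
  let ?p = "q(i := t)"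
  have p: "?p \<in> K" using it K Suc.prems by (auto simp: face_closed_def)
  have "weight D g N ?p \<noteq> 0" and gne: "g N ?p \<noteq> g N q" using it(4) by auto
  from Suc.IH[OF p this(1)] obtain c where
    c: "c N = ?p" "\<forall>r\<le>N. c r \<in> K" "\<forall>r<N. g r (c r) \<noteq> g r (c (Suc r)) \<and> (\<forall>i. \<bar>c (Suc r) i - c r i\<bar> \<le> 1)"
    by blast
  show ?case
    using c it(3) gne Suc.prems(1)
    by (intro exI[of _ "c(Suc N := q)"]) (auto simp: less_Suc_eq le_Suc_eq)
qed


section \<open>Pairing of chains and cochains on a finite grid\<close>

definition grid :: "nat \<Rightarrow> int \<Rightarrow> (nat \<Rightarrow> int) set" where
  "grid D L = {p. (\<forall>i<D. \<bar>p i\<bar> \<le> L) \<and> (\<forall>i\<ge>D. p i = 0)}"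

lemma finite_grid [simp]: "finite (grid D L)"
proof -
  have "finite {p :: nat \<Rightarrow> int. \<forall>i. (i \<in> {..<D} \<longrightarrow> p i \<in> {-L..L}) \<and> (i \<notin> {..<D} \<longrightarrow> p i = 0)}"
    by (intro finite_set_of_finite_funs) auto
  then show ?thesis
    by (rule finite_subset[rotated]) (auto simp: grid_def)
qed

lemma flip_grid [simp]: "flip J p \<in> grid D L \<longleftrightarrow> p \<in> grid D L"
  by (simp add: grid_def) (auto simp: flip_apply)

lemma sum_grid_flip: "(\<Sum>p\<in>grid D L. f (flip J p)) = sum f (grid D L)"
  by (rule sum.reindex_bij_witness[of _ "flip J" "flip J"]) auto

text \<open>Stokes' formula: each incidence of a cell and a face is counted once on either side. For
  even \<open>L\<close> the extreme coordinates are points, so faces of cells of the grid stay in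
  the grid.\<close>

lemma pairing_bd:
  assumes "even L" "\<And>p. p \<notin> grid D L \<Longrightarrow> X p = 0"
  shows "(\<Sum>p\<in>grid D L. bd D X p * F p) = (\<Sum>q\<in>grid D L. X q * cobd D F q)"
proof -
  \<comment> \<open>For a fixed direction and side, the substitution
    \<open>q = p(i := p i + s)\<close> matches faces with their cells.\<close>
  have *: "(\<Sum>p\<in>grid D L. if even (p i) then X (p(i := p i + s)) * F p else 0)
      = (\<Sum>q\<in>grid D L. if odd (q i) then X q * F (q(i := q i - s)) else 0)"
    if s: "\<bar>s\<bar> = 1" and i: "i < D" for s i
  proof -
    have "(\<Sum>p\<in>grid D L. if even (p i) then X (p(i := p i + s)) * F p else 0)
       = (\<Sum>p\<in>{p\<in>grid D L. even (p i) \<and> p(i := p i + s) \<in> grid D L}. X (p(i := p i + s)) * F p)"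
      by (rule sum.mono_neutral_cong_right) (auto simp: assms(2))
    also have "\<dots> = (\<Sum>q\<in>{q\<in>grid D L. odd (q i)}. X q * F (q(i := q i - s)))"
    proof (rule sum.reindex_bij_witness[of _ "\<lambda>q. q(i := q i - s)" "\<lambda>p. p(i := p i + s)"])
      fix q assume q: "q \<in> {q\<in>grid D L. odd (q i)}"
      then have "\<bar>q i\<bar> \<le> L" "\<bar>q i\<bar> \<noteq> L"
        using i assms(1) by (auto simp: grid_def)
      then have "\<bar>q i - s\<bar> \<le> L" using s by linarith
      then show "q(i := q i - s) \<in> {p\<in>grid D L. even (p i) \<and> p(i := p i + s) \<in> grid D L}"
        using q s i by (auto simp: grid_def abs_if split: if_splits)
    qed (use s in \<open>auto simp: abs_if split: if_splits\<close>)
    also have "\<dots> = (\<Sum>q\<in>grid D L. if odd (q i) then X q * F (q(i := q i - s)) else 0)"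
      by (rule sum.mono_neutral_cong_left) auto
    finally show ?thesis .
  qed
  have "(\<Sum>p\<in>grid D L. bd D X p * F p) =
    (\<Sum>p\<in>grid D L. \<Sum>i<D. (if even (p i) then X (p(i := p i + 1)) * F p else 0)
       + (if even (p i) then X (p(i := p i + (-1))) * F p else 0))"
    unfolding bd_def sum_distrib_right
    by (intro sum.cong refl) (auto simp: algebra_simps)
  also have "\<dots> = (\<Sum>i<D. (\<Sum>p\<in>grid D L. if even (p i) then X (p(i := p i + 1)) * F p else 0)
       + (\<Sum>p\<in>grid D L. if even (p i) then X (p(i := p i + (-1))) * F p else 0))"
    by (subst sum.swap) (simp only: sum.distrib)
  also have "\<dots> = (\<Sum>i<D. (\<Sum>q\<in>grid D L. if odd (q i) then X q * F (q(i := q i - 1)) else 0)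
       + (\<Sum>q\<in>grid D L. if odd (q i) then X q * F (q(i := q i - (-1))) else 0))"
    by (intro sum.cong refl arg_cong2[of _ _ _ _ "(+)"] *) auto
  also have "\<dots> = (\<Sum>q\<in>grid D L. \<Sum>i<D. (if odd (q i) then X q * F (q(i := q i - 1)) else 0)
       + (if odd (q i) then X q * F (q(i := q i - (-1))) else 0))"
    by (subst sum.swap) (simp only: sum.distrib)
  also have "\<dots> = (\<Sum>q\<in>grid D L. X q * cobd D F q)"
    unfolding cobd_def sum_distrib_left
    by (intro sum.cong refl) (auto simp: algebra_simps)
  finally show ?thesis .
qed

text \<open>By \<open>pairing_bd\<close> the left side pairs \<open>X\<close> with
  \<open>weight D g (Suc r)\<close>. This invariant cocycle is the sum of
  \<open>g (Suc r) * weight D g (Suc r)\<close> and its reflection, since the sign changes by 1;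
  moving the reflection over to \<open>X\<close> gives the right side.\<close>

lemma pairing_step:
  assumes L: "even L" and KG: "K \<subseteq> grid D L" and K: "face_closed D K" "\<And>p. p \<in> K \<Longrightarrow> flip J p \<in> K"
    and g: "\<And>r p. p \<in> K \<Longrightarrow> g r (flip J p) = g r p + 1"
    and X: "\<And>p. p \<notin> K \<Longrightarrow> X p = 0"
  shows "(\<Sum>p\<in>grid D L. bd D X p * (g r p * weight D g r p)) =
    (\<Sum>p\<in>grid D L. (X p + X (flip J p)) * (g (Suc r) p * weight D g (Suc r) p))"
proof -
  let ?w = "weight D g (Suc r)"
  have "(\<Sum>p\<in>grid D L. X (flip J p) * (g (Suc r) p * ?w p))
    = (\<Sum>p\<in>grid D L. X (flip J (flip J p)) * (g (Suc r) (flip J p) * ?w (flip J p)))"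
    by (rule sum_grid_flip[symmetric])
  also have "\<dots> = (\<Sum>p\<in>grid D L. X p * (g (Suc r) p * ?w p + ?w p))"
  proof (intro sum.cong refl)
    fix p
    show "X (flip J (flip J p)) * (g (Suc r) (flip J p) * ?w (flip J p)) = X p * (g (Suc r) p * ?w p + ?w p)"
    proof (cases "p \<in> K")
      case True
      have "?w (flip J p) = ?w p" by (rule weight_flip_antisym[OF K(1)]) (use g True in auto)
      then show ?thesis by (simp only: flip_flip g[OF True]) (simp add: algebra_simps)
    qed (simp add: X)
  qed
  finally have "(\<Sum>p\<in>grid D L. (X p + X (flip J p)) * (g (Suc r) p * ?w p)) = (\<Sum>p\<in>grid D L. X p * ?w p)"
    by (simp add: sum.distrib algebra_simps)
  moreover have "(\<Sum>p\<in>grid D L. bd D X p * (g r p * weight D g r p)) = (\<Sum>p\<in>grid D L. X p * ?w p)"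
    using pairing_bd[OF L, of D X "\<lambda>p. g r p * weight D g r p"] X KG by (simp add: subset_iff) blast
  ultimately show ?thesis by simp
qed

section \<open>Boxes and the boundary of a cube\<close>

text \<open>The product of one-dimensional chains, one in each of the first \<open>D\<close>
  directions.\<close>

definition box_chain :: "nat \<Rightarrow> (nat \<Rightarrow> int \<Rightarrow> bit) \<Rightarrow> (nat \<Rightarrow> int) \<Rightarrow> bit" where
  "box_chain D \<phi> p = of_bool (\<forall>i\<ge>D. p i = 0) * (\<Prod>i<D. \<phi> i (p i))"

definition bd1 :: "(int \<Rightarrow> bit) \<Rightarrow> int \<Rightarrow> bit" where
  "bd1 f t = (if even t then f (t + 1) + f (t - 1) else 0)"

lemma box_chain_factor:
  assumes "i < D"
  shows "box_chain D \<phi> p = \<phi> i (p i) * (of_bool (\<forall>i\<ge>D. p i = 0) * (\<Prod>j\<in>{..<D}-{i}. \<phi> j (p j)))"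
  using assms by (simp add: box_chain_def prod.remove[of _ i])

lemma box_chain_upd_fun:
  assumes "i < D"
  shows "box_chain D (\<phi>(i := f)) p = f (p i) * (of_bool (\<forall>i\<ge>D. p i = 0) * (\<Prod>j\<in>{..<D}-{i}. \<phi> j (p j)))"
proof -
  have "(\<Prod>j\<in>{..<D}-{i}. (\<phi>(i := f)) j (p j)) = (\<Prod>j\<in>{..<D}-{i}. \<phi> j (p j))"
    by (rule prod.cong) auto
  then show ?thesis unfolding box_chain_factor[OF assms] by simp
qed

lemma box_chain_upd_arg:
  assumes "i < D"
  shows "box_chain D \<phi> (p(i := t)) = \<phi> i t * (of_bool (\<forall>i\<ge>D. p i = 0) * (\<Prod>j\<in>{..<D}-{i}. \<phi> j (p j)))"
proof -
  have "(\<forall>k\<ge>D. (p(i := t)) k = 0) \<longleftrightarrow> (\<forall>k\<ge>D. p k = 0)" using assms by auto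
  moreover have "(\<Prod>j\<in>{..<D}-{i}. \<phi> j ((p(i := t)) j)) = (\<Prod>j\<in>{..<D}-{i}. \<phi> j (p j))"
    by (rule prod.cong) auto
  ultimately show ?thesis unfolding box_chain_factor[OF assms] by simp
qed

lemma box_chain_zero: "i < D \<Longrightarrow> \<phi> i = (\<lambda>_. 0) \<Longrightarrow> box_chain D \<phi> p = 0"
  by (simp add: box_chain_factor)

lemma box_chain_add:
  "i < D \<Longrightarrow> box_chain D (\<phi>(i := (\<lambda>t. f t + g t))) p = box_chain D (\<phi>(i := f)) p + box_chain D (\<phi>(i := g)) p"
  by (simp add: box_chain_upd_fun algebra_simps)

lemma box_chain_cong: "(\<And>i. i < D \<Longrightarrow> \<phi> i = \<psi> i) \<Longrightarrow> box_chain D \<phi> p = box_chain D \<psi> p"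
  unfolding box_chain_def by (intro arg_cong2[of _ _ _ _ "(*)"] prod.cong refl) auto

lemma box_chain_flip:
  "box_chain D \<phi> (flip J p) = box_chain D (\<lambda>i. if i \<in> J then \<lambda>t. \<phi> i (- t) else \<phi> i) p"
proof -
  have "(\<forall>i\<ge>D. flip J p i = 0) \<longleftrightarrow> (\<forall>i\<ge>D. p i = 0)" by (auto simp: flip_apply)
  then show ?thesis
    unfolding box_chain_def by (simp only:) (intro arg_cong2[of _ _ _ _ "(*)"] prod.cong refl, simp add: flip_apply)
qed

text \<open>The Leibniz rule, free of signs because the coefficients are mod 2.\<close>

lemma bd_box_chain: "bd D (box_chain D \<phi>) p = (\<Sum>i<D. box_chain D (\<phi>(i := bd1 (\<phi> i))) p)"
  unfolding bd_def
  by (intro sum.cong refl) (simp add: box_chain_upd_arg box_chain_upd_fun bd1_def algebra_simps)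

section \<open>Intervals and points as chains on the line\<close>

text \<open>As chains, these five are the interval [-L, L], its half [0, L], the pair of ends of
  [-L, L], the upper end alone, and the origin.\<close>

definition full_cell where "full_cell L t = (of_bool (odd t \<and> \<bar>t\<bar> < L) :: bit)" for L t :: int
definition half_cell where "half_cell L t = (of_bool (odd t \<and> 0 < t \<and> t < L) :: bit)" for L t :: int
definition ends_cell where "ends_cell L t = (of_bool (\<bar>t\<bar> = L) :: bit)" for L t :: int
definition top_cell where "top_cell L t = (of_bool (t = L) :: bit)" for L t :: int
definition zero_cell where "zero_cell t = (of_bool (t = 0) :: bit)" for t :: int

lemma bd1_cells:
  assumes "even L" "0 < L"
  shows "bd1 (full_cell L) = ends_cell L" "bd1 (half_cell L) = (\<lambda>t. zero_cell t + top_cell L t)"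
    "bd1 (ends_cell L) = (\<lambda>_. 0)" "bd1 (top_cell L) = (\<lambda>_. 0)" "bd1 zero_cell = (\<lambda>_. 0)"
proof -
  \<comment> \<open>Writing even numbers as doubles reduces the parity conditions to linear
    arithmetic.\<close>
  obtain m where L: "L = 2 * m" "0 < m" using assms by (auto elim: evenE)
  have odd_ne: "t \<noteq> L" "t \<noteq> - L" "t \<noteq> 0" "\<bar>t\<bar> \<noteq> L" if "odd t" for t
    using that assms(1) by (auto simp: abs_if)
  have "bd1 (full_cell L) t = ends_cell L t" for t
  proof (cases "even t")
    case True
    then obtain k where t: "t = 2 * k" by (auto elim: evenE)
    consider "\<bar>k\<bar> < m" | "k = m" | "\<bar>k\<bar> > m" | "k = - m" by linarith
    then show ?thesis
    proof cases
      case 1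
      then have "\<bar>t + 1\<bar> < L" "\<bar>t - 1\<bar> < L" "\<bar>t\<bar> \<noteq> L" unfolding t L(1) by linarith+
      then show ?thesis using True by (simp add: bd1_def full_cell_def ends_cell_def)
    next
      case 2
      then have "\<not> \<bar>t + 1\<bar> < L" "\<bar>t - 1\<bar> < L" "\<bar>t\<bar> = L" using L(2) unfolding t L(1) by linarith+
      then show ?thesis using True by (simp add: bd1_def full_cell_def ends_cell_def)
    next
      case 3
      then have "\<not> \<bar>t + 1\<bar> < L" "\<not> \<bar>t - 1\<bar> < L" "\<bar>t\<bar> \<noteq> L" unfolding t L(1) by linarith+
      then show ?thesis using True by (simp add: bd1_def full_cell_def ends_cell_def)
    next
      case 4
      then have "\<bar>t + 1\<bar> < L" "\<not> \<bar>t - 1\<bar> < L" "\<bar>t\<bar> = L" using L(2) unfolding t L(1) by linarith+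
      then show ?thesis using True by (simp add: bd1_def full_cell_def ends_cell_def)
    qed
  qed (simp add: bd1_def ends_cell_def odd_ne)
  then show "bd1 (full_cell L) = ends_cell L" by blast
  have "bd1 (half_cell L) t = zero_cell t + top_cell L t" for t
  proof (cases "even t")
    case True
    then obtain k where t: "t = 2 * k" by (auto elim: evenE)
    have k: "k = 0 \<or> k = m \<or> 0 < k \<and> k < m \<or> k < 0 \<or> k > m" by linarith
    define P Q where "P = (0 < t + 1 \<and> t + 1 < L)" and "Q = (0 < t - 1 \<and> t - 1 < L)"
    from k have "P = Q \<and> t \<noteq> 0 \<and> t \<noteq> L \<or> P \<noteq> Q \<and> (t = 0 \<or> t = L)"
      using L(2) unfolding P_def Q_def t L(1) by (elim disjE) linarith+
    moreover have "half_cell L (t + 1) = of_bool P" "half_cell L (t - 1) = of_bool Q"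
      unfolding P_def Q_def half_cell_def using True by auto
    moreover have "\<not> (t = 0 \<and> t = L)" using assms by auto
    ultimately show ?thesis using True
      by (cases P; cases Q) (auto simp add: bd1_def zero_cell_def top_cell_def)
  qed (simp add: bd1_def zero_cell_def top_cell_def odd_ne)
  then show "bd1 (half_cell L) = (\<lambda>t. zero_cell t + top_cell L t)" by blast
  have "bd1 (ends_cell L) t = 0 \<and> bd1 (top_cell L) t = 0 \<and> bd1 zero_cell t = 0" for t
    using odd_ne[of "t + 1"] odd_ne[of "t - 1"]
    by (simp add: bd1_def ends_cell_def top_cell_def zero_cell_def)
  then show "bd1 (ends_cell L) = (\<lambda>_. 0)" "bd1 (top_cell L) = (\<lambda>_. 0)" "bd1 zero_cell = (\<lambda>_. 0)"
    by blast+
qed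

lemma cells_neg:
  "full_cell L (- t) = full_cell L t" "ends_cell L (- t) = ends_cell L t" "zero_cell (- t) = zero_cell t"
  by (auto simp: full_cell_def ends_cell_def zero_cell_def)

text \<open>An odd cell avoids the origin and so lies in exactly one half; \<open>0 < L\<close>
  keeps the two ends apart.\<close>

lemma cells_split:
  assumes "0 < L"
  shows "full_cell L t = half_cell L t + half_cell L (- t)" "ends_cell L t = top_cell L t + top_cell L (- t)"
  using assms by (cases "t = 0"; auto simp: full_cell_def half_cell_def ends_cell_def top_cell_def abs_if)+

text \<open>The product of the boundary of the a-dimensional cube with the factors \<open>\<psi> j\<close>, j \<open>\<ge>\<close> a.\<close>

definition sphere_chain :: "nat \<Rightarrow> int \<Rightarrow> nat \<Rightarrow> (nat \<Rightarrow> int \<Rightarrow> bit) \<Rightarrow> (nat \<Rightarrow> int) \<Rightarrow> bit" where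
  "sphere_chain D L a \<psi> p =
     (\<Sum>i<a. box_chain D (\<lambda>j. if j < a then if j = i then ends_cell L else full_cell L else \<psi> j) p)"

lemma sphere_chain_cong:
  "(\<And>i. a \<le> i \<Longrightarrow> i < D \<Longrightarrow> \<phi> i = \<psi> i) \<Longrightarrow> sphere_chain D L a \<phi> p = sphere_chain D L a \<psi> p"
  unfolding sphere_chain_def by (intro sum.cong refl box_chain_cong) auto

lemma sphere_chain_zero:
  "a \<le> i \<Longrightarrow> i < D \<Longrightarrow> \<psi> i = (\<lambda>_. 0) \<Longrightarrow> sphere_chain D L a \<psi> p = 0"
  unfolding sphere_chain_def by (intro sum.neutral ballI box_chain_zero[of i]) auto

lemma sphere_chain_add:
  assumes "a \<le> i" "i < D"
  shows "sphere_chain D L a (\<psi>(i := (\<lambda>t. f t + g t))) p =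
    sphere_chain D L a (\<psi>(i := f)) p + sphere_chain D L a (\<psi>(i := g)) p"
proof -
  have *: "(\<lambda>j. if j < a then if j = k then ends_cell L else full_cell L else (\<psi>(i := h)) j) =
     (\<lambda>j. if j < a then if j = k then ends_cell L else full_cell L else \<psi> j)(i := h)" for k h
    using assms by auto
  show ?thesis
    unfolding sphere_chain_def * box_chain_add[OF assms(2)] by (rule sum.distrib)
qed

lemma sphere_chain_flip:
  "sphere_chain D L a \<psi> (flip J p) = sphere_chain D L a (\<lambda>i. if i \<in> J then \<lambda>t. \<psi> i (- t) else \<psi> i) p"
  unfolding sphere_chain_def box_chain_flip
  by (intro sum.cong refl box_chain_cong) (auto simp: cells_neg fun_eq_iff)

text \<open>The boundary of the cube is closed: in its boundary two coordinates sit at their ends,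
  and each such pair arises twice. Only the boundaries of the factors from \<open>a\<close> on
  remain.\<close>

lemma bd_sphere_chain:
  assumes L: "even L" "0 < L" and a: "a \<le> D"
  shows "bd D (sphere_chain D L a \<psi>) p = (\<Sum>l\<in>{a..<D}. sphere_chain D L a (\<psi>(l := bd1 (\<psi> l))) p)"
proof -
  define \<phi> where "\<phi> i = (\<lambda>j. if j < a then if j = i then ends_cell L else full_cell L else \<psi> j)" for i
  \<comment> \<open>The diagonal is 0 because the ends of an interval have no boundary.\<close>
  define S where "S i l = (if i = l then 0 else box_chain D ((\<phi> i)(l := ends_cell L)) p)" for i l
  have "bd D (sphere_chain D L a \<psi>) p = (\<Sum>i<a. bd D (box_chain D (\<phi> i)) p)"
    unfolding sphere_chain_def[abs_def] \<phi>_def by (rule bd_sum) simp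
  also have "\<dots> = (\<Sum>i<a. \<Sum>l<D. box_chain D ((\<phi> i)(l := bd1 (\<phi> i l))) p)"
    by (simp add: bd_box_chain)
  also have "\<dots> = (\<Sum>i<a. (\<Sum>l<a. S i l) + (\<Sum>l\<in>{a..<D}. box_chain D ((\<phi> i)(l := bd1 (\<psi> l))) p))"
  proof (intro sum.cong refl)
    fix i assume i: "i \<in> {..<a}"
    have un: "{..<D} = {..<a} \<union> {a..<D}" using a by auto
    have "(\<Sum>l<D. box_chain D ((\<phi> i)(l := bd1 (\<phi> i l))) p) =
      (\<Sum>l<a. box_chain D ((\<phi> i)(l := bd1 (\<phi> i l))) p) + (\<Sum>l\<in>{a..<D}. box_chain D ((\<phi> i)(l := bd1 (\<phi> i l))) p)"
      unfolding un by (rule sum.union_disjoint) auto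
    also have "(\<Sum>l<a. box_chain D ((\<phi> i)(l := bd1 (\<phi> i l))) p) = (\<Sum>l<a. S i l)"
    proof (intro sum.cong refl)
      fix l assume "l \<in> {..<a}"
      then show "box_chain D ((\<phi> i)(l := bd1 (\<phi> i l))) p = S i l"
        using i a by (cases "i = l") (simp_all add: S_def \<phi>_def bd1_cells[OF L] box_chain_zero[of l])
    qed
    also have "(\<Sum>l\<in>{a..<D}. box_chain D ((\<phi> i)(l := bd1 (\<phi> i l))) p) =
       (\<Sum>l\<in>{a..<D}. box_chain D ((\<phi> i)(l := bd1 (\<psi> l))) p)"
      by (intro sum.cong refl) (auto simp: \<phi>_def)
    finally show "(\<Sum>l<D. box_chain D ((\<phi> i)(l := bd1 (\<phi> i l))) p) =
      (\<Sum>l<a. S i l) + (\<Sum>l\<in>{a..<D}. box_chain D ((\<phi> i)(l := bd1 (\<psi> l))) p)" .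
  qed
  also have "\<dots> = (\<Sum>i<a. \<Sum>l\<in>{a..<D}. box_chain D ((\<phi> i)(l := bd1 (\<psi> l))) p)"
  proof -
    have "(\<Sum>i<a. \<Sum>l<a. S i l) = 0"
    proof (rule sum_symmetric_bit)
      fix i l assume *: "i \<in> {..<a}" "l \<in> {..<a}"
      have "(\<phi> i)(l := ends_cell L) = (\<phi> l)(i := ends_cell L)" if "i \<noteq> l"
        using that * by (auto simp: \<phi>_def)
      then show "S i l = S l i" by (simp add: S_def)
    qed (simp_all add: S_def)
    then show ?thesis by (simp add: sum.distrib)
  qed
  also have "\<dots> = (\<Sum>l\<in>{a..<D}. sphere_chain D L a (\<psi>(l := bd1 (\<psi> l))) p)"
    unfolding sphere_chain_def \<phi>_def
  proof (subst sum.swap, intro sum.cong refl)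
    fix l i assume "l \<in> {a..<D}" "i \<in> {..<a}"
    then have "(\<lambda>j. if j < a then if j = i then ends_cell L else full_cell L else \<psi> j)(l := bd1 (\<psi> l)) =
      (\<lambda>j. if j < a then if j = i then ends_cell L else full_cell L else (\<psi>(l := bd1 (\<psi> l))) j)"
      by (auto simp: fun_eq_iff)
    then show "box_chain D ((\<lambda>j. if j < a then if j = i then ends_cell L else full_cell L else \<psi> j)(l := bd1 (\<psi> l))) p =
      box_chain D (\<lambda>j. if j < a then if j = i then ends_cell L else full_cell L else (\<psi>(l := bd1 (\<psi> l))) j) p"
      by simp
  qed
  finally show ?thesis .
qed

lemma sphere_chain_support:
  assumes "sphere_chain D L a \<psi> p \<noteq> 0" "a \<le> D" "0 < L"
  shows "\<exists>i<a. \<bar>p i\<bar> = L" "\<And>j. j < a \<Longrightarrow> \<bar>p j\<bar> \<le> L" "\<And>j. a \<le> j \<Longrightarrow> j < D \<Longrightarrow> \<psi> j (p j) \<noteq> 0"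
    "\<And>j. D \<le> j \<Longrightarrow> p j = 0"
proof -
  define \<phi> where "\<phi> i j = (if j < a then if j = i then ends_cell L else full_cell L else \<psi> j)" for i j
  have "(\<Sum>i<a. box_chain D (\<phi> i) p) \<noteq> 0"
    using assms(1) unfolding sphere_chain_def \<phi>_def .
  then obtain i where i: "i \<in> {..<a}" and nz: "box_chain D (\<phi> i) p \<noteq> 0"
    by (rule sum.not_neutral_contains_not_neutral)
  have z: "\<forall>j\<ge>D. p j = 0"
  proof (rule ccontr)
    assume "\<not> (\<forall>j\<ge>D. p j = 0)"
    then have "box_chain D (\<phi> i) p = 0" unfolding box_chain_def by (simp only: of_bool_eq mult_zero_left)
    with nz show False by contradiction
  qed
  have *: "\<phi> i j (p j) \<noteq> 0" if "j < D" for j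
    using nz box_chain_factor[OF that, of "\<phi> i" p] by auto
  have "\<bar>p i\<bar> = L"
    using *[of i] i assms(2) by (simp add: ends_cell_def \<phi>_def split: if_splits)
  then show "\<exists>i<a. \<bar>p i\<bar> = L" using i by blast
  show "\<bar>p j\<bar> \<le> L" if "j < a" for j
    using *[of j] that assms(2) by (cases "j = i") (simp_all add: ends_cell_def full_cell_def \<phi>_def)
  show "\<psi> j (p j) \<noteq> 0" if "a \<le> j" "j < D" for j
    using *[of j] that by (simp add: \<phi>_def)
  show "p j = 0" if "D \<le> j" for j using z that by blast
qed

text \<open>The antipodal map preserves every factor except the half interval, and the two halves
  add up to the full one.\<close>

lemma sphere_chain_half:
  assumes L: "0 < L" and l: "a \<le> l" "l < D" and \<psi>: "\<And>i t. \<psi> i (- t) = \<psi> i t"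
  shows "sphere_chain D L a (\<psi>(l := half_cell L)) p + sphere_chain D L a (\<psi>(l := half_cell L)) (flip UNIV p)
    = sphere_chain D L a (\<psi>(l := full_cell L)) p"
proof -
  have "sphere_chain D L a (\<psi>(l := half_cell L)) (flip UNIV p) =
     sphere_chain D L a (\<psi>(l := (\<lambda>t. half_cell L (- t)))) p"
    unfolding sphere_chain_flip by (intro sphere_chain_cong) (auto simp: \<psi> fun_eq_iff)
  moreover have "full_cell L = (\<lambda>t. half_cell L t + half_cell L (- t))"
    using cells_split(1)[OF L] by blast
  ultimately show ?thesis by (simp add: sphere_chain_add[OF l])
qed

text \<open>The even numbers L and -L are never odd coordinates, so passing to a face changes no
  extreme coordinate and does not leave the grid. Sets of cells defined by having extreme
  coordinates are therefore closed under faces.\<close>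

lemma odd_coordinate_upd:
  assumes L: "even (L::int)" and q: "q \<in> grid D L" "odd (q i)" "i < D" "\<bar>t - q i\<bar> = 1"
  shows "q(i := t) \<in> grid D L" "\<bar>q l\<bar> = L \<Longrightarrow> \<bar>(q(i := t)) l\<bar> = L"
proof -
  have ne: "\<bar>q i\<bar> \<noteq> L" using L q by auto
  moreover have "\<bar>q i\<bar> \<le> L" using q by (auto simp: grid_def)
  ultimately have "\<bar>t\<bar> \<le> L" using q(4) by linarith
  then show "q(i := t) \<in> grid D L" using q by (auto simp: grid_def)
  show "\<bar>(q(i := t)) l\<bar> = L" if "\<bar>q l\<bar> = L" using that ne by (cases "l = i") auto
qed

section \<open>A Borsuk--Ulam type theorem\<close>

text \<open>A nonzero pairing is propagated upwards: through spheres up to the boundary of the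
  \<open>a\<close>-dimensional cube, then through its products with cubes in the remaining
  directions. Each step applies Stokes' formula to half of the new chain. At the end some cell has
  nonzero weight, and \<open>weight_chain\<close> extracts the sign changes.\<close>

lemma antisymmetric_signs_chain:
  fixes L :: int and D a :: nat and g :: "nat \<Rightarrow> (nat \<Rightarrow> int) \<Rightarrow> bit"
  defines "K \<equiv> {p \<in> grid D L. \<exists>i<a. \<bar>p i\<bar> = L}"
  assumes L: "even L" "0 < L" and a: "0 < a" "a \<le> D"
    and g_anti: "\<And>r p. p \<in> K \<Longrightarrow> g r (flip UNIV p) = g r p + 1"
    and g_sym: "\<And>r p. p \<in> K \<Longrightarrow> \<exists>l\<in>{a..<D}. \<bar>p l\<bar> = L \<Longrightarrow> g r (flip {..<a} p) = g r p"
  shows "\<exists>c. (\<forall>r<D. c r \<in> K) \<and>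
     (\<forall>r<D-1. g r (c r) \<noteq> g r (c (Suc r)) \<and> (\<forall>i. \<bar>c (Suc r) i - c r i\<bar> \<le> 1))"
proof -
  define P where "P r X = (\<Sum>p\<in>grid D L. X p * (g r p * weight D g r p))" for r X
  \<comment> \<open>The cells over the boundary of the cube factor, where the second symmetry is
    available.\<close>
  define K' where "K' = {p \<in> K. \<exists>l\<in>{a..<D}. \<bar>p l\<bar> = L}"
  have K: "face_closed D K" "K \<subseteq> grid D L" "\<And>J p. p \<in> K \<Longrightarrow> flip J p \<in> K"
  proof -
    show "face_closed D K" unfolding face_closed_def
    proof (intro ballI allI impI)
      fix q i t assume q: "q \<in> K" "i < D" "odd (q i)" "\<bar>t - q i\<bar> = 1"
      then show "q(i := t) \<in> K"
        using odd_coordinate_upd[OF L(1), of q D i t] unfolding K_def by blast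
    qed
  qed (auto simp: K_def)
  have K': "face_closed D K'" unfolding face_closed_def
  proof (intro ballI allI impI)
    fix q i t assume q: "q \<in> K'" "i < D" "odd (q i)" "\<bar>t - q i\<bar> = 1"
    then show "q(i := t) \<in> K'"
      using odd_coordinate_upd[OF L(1), of q D i t] unfolding K'_def K_def by blast
  qed
  \<comment> \<open>For \<open>X\<close> half of a symmetric chain, this passes from the boundary of
    the half to the whole chain and raises the index by one.\<close>
  have step: "P r (bd D X) = P (Suc r) (\<lambda>p. X p + X (flip UNIV p))"
    if "\<And>p. X p \<noteq> 0 \<Longrightarrow> p \<in> K" for X r
    unfolding P_def
    by (rule pairing_step[OF L(1) K(2,1)]) (use that g_anti K(3) in blast)+
  have P_add: "P r (\<lambda>p. X p + Y p) = P r X + P r Y" for r X Y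
    by (simp add: P_def sum.distrib algebra_simps)
  have P_sum: "P r (\<lambda>p. \<Sum>i\<in>A. X i p) = (\<Sum>i\<in>A. P r (X i))" if "finite A" for r X and A :: "nat set"
    using that by (induction A rule: finite_induct) (simp_all add: P_add, simp add: P_def)
  have in_K: "p \<in> K" if "sphere_chain D L b \<psi> p \<noteq> 0" "b \<le> a"
    "\<And>j t. b \<le> j \<Longrightarrow> j < D \<Longrightarrow> \<psi> j t \<noteq> 0 \<Longrightarrow> \<bar>t\<bar> \<le> L" for b \<psi> p
  proof -
    have "b \<le> D" using that a by simp
    note s = sphere_chain_support[OF that(1) this L(2)]
    show ?thesis using s(1,4) that(2) s(2) s(3) that(3)
      unfolding K_def grid_def by (simp, metis le_less_trans less_le_trans not_le)
  qed
  \<comment> \<open>All cells of such a chain lie in \<open>K'\<close>, where reflecting the first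
    \<open>a\<close> coordinates preserves chain, sign and weight. No cell is fixed, since some
    coordinate below \<open>a\<close> is L or -L, so the cells cancel in pairs.\<close>
  have P_sym: "P r (sphere_chain D L a \<psi>) = 0"
    if l: "a \<le> l" "l < D" "\<And>t. \<psi> l t \<noteq> 0 \<Longrightarrow> \<bar>t\<bar> = L"
      and b: "\<And>j t. a \<le> j \<Longrightarrow> j < D \<Longrightarrow> \<psi> j t \<noteq> 0 \<Longrightarrow> \<bar>t\<bar> \<le> L" for r \<psi> l
  proof -
    let ?X = "sphere_chain D L a \<psi>"
    let ?A = "{p \<in> grid D L. ?X p \<noteq> 0}"
    have X_flip: "?X (flip {..<a} p) = ?X p" for p
      unfolding sphere_chain_flip by (rule sphere_chain_cong) auto
    have "P r ?X = (\<Sum>p\<in>?A. ?X p * (g r p * weight D g r p))"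
      unfolding P_def by (rule sum.mono_neutral_right) auto
    also have "\<dots> = 0"
    proof (rule sum_involution_bit[where \<sigma> = "flip {..<a}"])
      fix p assume p: "p \<in> ?A"
      then have X: "?X p \<noteq> 0" by simp
      have pK: "p \<in> K" by (rule in_K[OF X _ b]) auto
      note s = sphere_chain_support[OF X a(2) L(2)]
      have pl: "\<bar>p l\<bar> = L" using s(3)[OF l(1,2)] l(3) by blast
      have pK': "p \<in> K'" using pK pl l by (auto simp: K'_def)
      obtain i where i: "i < a" "\<bar>p i\<bar> = L" using s(1) by blast
      have "flip {..<a} p i \<noteq> p i" using i L(2) by (auto simp: flip_apply)
      then have "flip {..<a} p \<noteq> p" by auto
      moreover have "weight D g r (flip {..<a} p) = weight D g r p"
        by (rule weight_flip_sym[OF K' _ pK']) (auto simp: K'_def intro!: g_sym)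
      moreover have "g r (flip {..<a} p) = g r p" using pK' by (auto simp: K'_def intro!: g_sym)
      ultimately show "flip {..<a} p \<in> ?A \<and> flip {..<a} p \<noteq> p \<and> flip {..<a} (flip {..<a} p) = p \<and>
         ?X (flip {..<a} p) * (g r (flip {..<a} p) * weight D g r (flip {..<a} p)) =
         ?X p * (g r p * weight D g r p)"
        using p by (simp add: X_flip)
    qed simp
    finally show ?thesis .
  qed
  have cells_le: "full_cell L t \<noteq> 0 \<Longrightarrow> \<bar>t\<bar> \<le> L" "half_cell L t \<noteq> 0 \<Longrightarrow> \<bar>t\<bar> \<le> L" "top_cell L t \<noteq> 0 \<Longrightarrow> \<bar>t\<bar> = L"
     "ends_cell L t \<noteq> 0 \<Longrightarrow> \<bar>t\<bar> = L" "zero_cell t \<noteq> 0 \<Longrightarrow> \<bar>t\<bar> \<le> L" for t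
    using L by (auto simp: full_cell_def half_cell_def top_cell_def ends_cell_def zero_cell_def)
  \<comment> \<open>The 0-sphere is a pair of antipodal points, on which the sign takes both
    values.\<close>
  have base: "P 0 (sphere_chain D L (Suc 0) (\<lambda>_. zero_cell)) = 1"
  proof -
    let ?X = "sphere_chain D L (Suc 0) (\<lambda>_. zero_cell)"
    define p where "p = (\<lambda>i::nat. if i = 0 then L else 0)"
    have pK: "p \<in> K" using a L by (auto simp: p_def K_def grid_def)
    have ne: "flip UNIV p \<noteq> p"
      using L(2) by (auto simp: p_def flip_def fun_eq_iff)
    have supp: "q = p \<or> q = flip UNIV p" if X: "?X q \<noteq> 0" for q
    proof -
      have D: "Suc 0 \<le> D" using a by simp
      note s = sphere_chain_support[OF X D L(2)]
      have "q j = 0" if "j \<noteq> 0" for j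
        using s(3)[of j] s(4)[of j] that by (cases "j < D") (auto simp: zero_cell_def)
      moreover have "q 0 = L \<or> q 0 = - L" using s(1) by auto
      ultimately show ?thesis by (auto simp: p_def flip_def fun_eq_iff)
    qed
    have "?X p = 1"
      using a L(2) unfolding sphere_chain_def box_chain_def
      by (simp add: p_def) (rule prod.neutral, simp add: ends_cell_def zero_cell_def)
    moreover have "?X (flip UNIV p) = ?X p"
      unfolding sphere_chain_flip by (rule sphere_chain_cong) (auto simp: cells_neg)
    moreover have "P 0 ?X = (\<Sum>q\<in>{p, flip UNIV p}. ?X q * (g 0 q * weight D g 0 q))"
      unfolding P_def
    proof (rule sum.mono_neutral_right)
      show "\<forall>q\<in>grid D L - {p, flip UNIV p}. ?X q * (g 0 q * weight D g 0 q) = 0"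
        using supp by (metis Diff_iff insert_iff mult_zero_left)
    qed (use pK K in auto)
    ultimately show ?thesis
      using ne[symmetric] g_anti[OF pK, of 0] by simp
  qed
  \<comment> \<open>The chain X is a hemisphere: its antipodal double is the sphere and its boundary the equator.\<close>
  have phase1: "Suc b \<le> a \<Longrightarrow> P b (sphere_chain D L (Suc b) (\<lambda>_. zero_cell)) = 1" for b
  proof (induction b)
    case (Suc b)
    define k where "k = Suc b"
    have k: "k < a" "k < D" "k \<le> k" using Suc.prems a by (auto simp: k_def)
    define \<phi> where "\<phi> c j = (if j < k then full_cell L else if j = k then c else zero_cell)" for c j
    define X where "X p = box_chain D (\<phi> (top_cell L)) p + sphere_chain D L k ((\<lambda>_. zero_cell)(k := half_cell L)) p" for p
    \<comment> \<open>The boundary of the next cube consists of two caps in direction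
      \<open>k\<close> and a lateral part over the boundary of the previous cube.\<close>
    have \<phi>_sphere: "sphere_chain D L (Suc k) (\<lambda>_. zero_cell) p =
       box_chain D (\<phi> (ends_cell L)) p + sphere_chain D L k ((\<lambda>_. zero_cell)(k := full_cell L)) p" for p
    proof -
      have "sphere_chain D L (Suc k) (\<lambda>_. zero_cell) p =
        box_chain D (\<lambda>j. if j < Suc k then if j = k then ends_cell L else full_cell L else zero_cell) p +
        (\<Sum>i<k. box_chain D (\<lambda>j. if j < Suc k then if j = i then ends_cell L else full_cell L else zero_cell) p)"
        by (simp add: sphere_chain_def add.commute)
      also have "box_chain D (\<lambda>j. if j < Suc k then if j = k then ends_cell L else full_cell L else zero_cell) p
         = box_chain D (\<phi> (ends_cell L)) p"
        by (rule box_chain_cong) (auto simp: \<phi>_def)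
      also have "(\<Sum>i<k. box_chain D (\<lambda>j. if j < Suc k then if j = i then ends_cell L else full_cell L else zero_cell) p)
         = sphere_chain D L k ((\<lambda>_. zero_cell)(k := full_cell L)) p"
        unfolding sphere_chain_def by (intro sum.cong refl box_chain_cong) auto
      finally show ?thesis .
    qed
    have X_sum: "X p + X (flip UNIV p) = sphere_chain D L (Suc k) (\<lambda>_. zero_cell) p" for p
    proof -
      have "box_chain D (\<phi> (top_cell L)) (flip UNIV p) = box_chain D ((\<phi> (top_cell L))(k := (\<lambda>t. top_cell L (- t)))) p"
        unfolding box_chain_flip by (rule box_chain_cong) (auto simp: \<phi>_def cells_neg)
      moreover have "box_chain D (\<phi> (top_cell L)) p = box_chain D ((\<phi> (top_cell L))(k := top_cell L)) p"
        by (rule box_chain_cong) (auto simp: \<phi>_def)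
      moreover have "box_chain D (\<phi> (ends_cell L)) p = box_chain D ((\<phi> (top_cell L))(k := (\<lambda>t. top_cell L t + top_cell L (- t)))) p"
        by (rule box_chain_cong) (auto simp: \<phi>_def cells_split(2)[OF L(2)])
      ultimately have "box_chain D (\<phi> (ends_cell L)) p = box_chain D (\<phi> (top_cell L)) p + box_chain D (\<phi> (top_cell L)) (flip UNIV p)"
        by (simp add: box_chain_add[OF k(2)])
      then show ?thesis
        unfolding \<phi>_sphere X_def
        using sphere_chain_half[OF L(2) k(3,2), of "\<lambda>_. zero_cell" p] cells_neg(3) by (simp add: ac_simps)
    qed
    have X_K: "p \<in> K" if nz: "X p \<noteq> 0" for p
    proof -
      consider "box_chain D (\<phi> (top_cell L)) p \<noteq> 0" | "sphere_chain D L k ((\<lambda>_. zero_cell)(k := half_cell L)) p \<noteq> 0"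
        using nz unfolding X_def by (metis add_0)
      then show ?thesis
      proof cases
        case 1
        have f: "\<phi> (top_cell L) j (p j) \<noteq> 0" if "j < D" for j
          using 1 box_chain_factor[OF that, of "\<phi> (top_cell L)" p] by auto
        have z: "\<forall>j\<ge>D. p j = 0"
        proof (rule ccontr)
          assume "\<not> (\<forall>j\<ge>D. p j = 0)"
          then have "box_chain D (\<phi> (top_cell L)) p = 0" unfolding box_chain_def by (simp only: of_bool_eq mult_zero_left)
          with 1 show False by contradiction
        qed
        have "\<bar>p k\<bar> = L" using f[OF k(2)] cells_le(3) by (simp add: \<phi>_def)
        moreover have "\<bar>p j\<bar> \<le> L" if "j < D" for j
          using f[OF that] cells_le[of "p j"] by (simp add: \<phi>_def split: if_splits)
        ultimately show ?thesis using z k(1) by (auto simp: K_def grid_def)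
      next
        case 2
        show ?thesis
          by (rule in_K[OF 2]) (use k cells_le in \<open>auto split: if_splits\<close>)
      qed
    qed
    \<comment> \<open>The rim of the cap at height L also bounds the lateral half and cancels; the
      equator at height 0 remains.\<close>
    have bd_X: "bd D X p = sphere_chain D L k (\<lambda>_. zero_cell) p" for p
    proof -
      have "bd D (box_chain D (\<phi> (top_cell L))) p = (\<Sum>i<k. box_chain D ((\<phi> (top_cell L))(i := bd1 (\<phi> (top_cell L) i))) p)"
        unfolding bd_box_chain
      proof (rule sum.mono_neutral_right)
        show "\<forall>i\<in>{..<D} - {..<k}. box_chain D ((\<phi> (top_cell L))(i := bd1 (\<phi> (top_cell L) i))) p = 0"
        proof
          fix i assume "i \<in> {..<D} - {..<k}"
          then show "box_chain D ((\<phi> (top_cell L))(i := bd1 (\<phi> (top_cell L) i))) p = 0"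
            by (intro box_chain_zero[of i]) (auto simp: \<phi>_def bd1_cells[OF L])
        qed
      qed (use k in auto)
      also have "\<dots> = sphere_chain D L k ((\<lambda>_. zero_cell)(k := top_cell L)) p"
        unfolding sphere_chain_def
        by (intro sum.cong refl box_chain_cong) (auto simp: \<phi>_def bd1_cells[OF L])
      finally have 1: "bd D (box_chain D (\<phi> (top_cell L))) p = sphere_chain D L k ((\<lambda>_. zero_cell)(k := top_cell L)) p" .
      let ?\<psi> = "(\<lambda>_. zero_cell)(k := half_cell L)"
      have "bd D (sphere_chain D L k ?\<psi>) p = (\<Sum>l\<in>{k..<D}. sphere_chain D L k (?\<psi>(l := bd1 (?\<psi> l))) p)"
        using k by (intro bd_sphere_chain[OF L]) auto
      also have "\<dots> = (\<Sum>l\<in>{k}. sphere_chain D L k (?\<psi>(l := bd1 (?\<psi> l))) p)"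
      proof (rule sum.mono_neutral_right)
        show "\<forall>l\<in>{k..<D} - {k}. sphere_chain D L k (?\<psi>(l := bd1 (?\<psi> l))) p = 0"
        proof
          fix l assume "l \<in> {k..<D} - {k}"
          then show "sphere_chain D L k (?\<psi>(l := bd1 (?\<psi> l))) p = 0"
            by (intro sphere_chain_zero[of k l]) (auto simp: bd1_cells[OF L])
        qed
      qed (use k in auto)
      also have "\<dots> = sphere_chain D L k ((\<lambda>_. zero_cell)(k := (\<lambda>t. zero_cell t + top_cell L t))) p"
        by (simp add: bd1_cells[OF L])
      also have "\<dots> = sphere_chain D L k (\<lambda>_. zero_cell) p + sphere_chain D L k ((\<lambda>_. zero_cell)(k := top_cell L)) p"
        unfolding sphere_chain_add[OF k(3,2)] by (simp add: fun_upd_idem)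
      finally show ?thesis unfolding X_def[abs_def] bd_add 1 by (simp add: ac_simps)
    qed
    have "P (Suc b) (sphere_chain D L (Suc k) (\<lambda>_. zero_cell)) = P b (bd D X)"
      using step[of X b] X_K X_sum by simp
    also have "bd D X = sphere_chain D L k (\<lambda>_. zero_cell)" using bd_X by blast
    finally show ?case using Suc by (simp add: k_def)
  qed (use base in simp)
  define \<psi> where "\<psi> c j = (if j < a + c then full_cell L else zero_cell)" for c j
  \<comment> \<open>Halving the last cube coordinate now leaves, besides the equator, boundary terms on which the
    reflection of the first a coordinates acts freely; these contribute nothing by \<open>P_sym\<close>.\<close>
  have phase2: "c \<le> D - a \<Longrightarrow> P (a - 1 + c) (sphere_chain D L a (\<psi> c)) = 1" for c
  proof (induction c)
    case 0
    have "sphere_chain D L a (\<psi> 0) p = sphere_chain D L a (\<lambda>_. zero_cell) p" for p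
      by (rule sphere_chain_cong) (auto simp: \<psi>_def)
    then have "sphere_chain D L a (\<psi> 0) = sphere_chain D L a (\<lambda>_. zero_cell)" by blast
    then show ?case using phase1[of "a - 1"] a by simp
  next
    case (Suc c)
    define k where "k = a + c"
    have k: "a \<le> k" "k < D" using Suc.prems a by (auto simp: k_def)
    define \<theta> where "\<theta> = (\<psi> c)(k := half_cell L)"
    define X where "X = sphere_chain D L a \<theta>"
    have \<theta>_le: "\<theta> j t \<noteq> 0 \<Longrightarrow> \<bar>t\<bar> \<le> L" for j t
      using cells_le[of t] by (simp add: \<theta>_def \<psi>_def split: if_splits)
    have X_K: "p \<in> K" if "X p \<noteq> 0" for p
      by (rule in_K[OF that[unfolded X_def]]) (use \<theta>_le in auto)
    have "X p + X (flip UNIV p) = sphere_chain D L a (\<psi> (Suc c)) p" for p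
    proof -
      have "(\<psi> c)(k := full_cell L) = \<psi> (Suc c)" by (auto simp: \<psi>_def k_def fun_eq_iff)
      then show ?thesis unfolding X_def \<theta>_def
        using sphere_chain_half[OF L(2) k, of "\<psi> c" p] cells_neg by (simp add: \<psi>_def)
    qed
    then have 1: "P (Suc (a - 1 + c)) (sphere_chain D L a (\<psi> (Suc c))) = P (a - 1 + c) (bd D X)"
      using step[of X "a - 1 + c"] X_K by simp
    \<comment> \<open>The half interval contributes the previous chain at 0 and a top part at L, and
      each earlier cube direction contributes its ends. Directions beyond \<open>k\<close> are
      points, without boundary.\<close>
    have "bd D X p = sphere_chain D L a (\<psi> c) p + (sphere_chain D L a (\<theta>(k := top_cell L)) p +
        (\<Sum>l\<in>{a..<k}. sphere_chain D L a (\<theta>(l := ends_cell L)) p))" for p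
    proof -
      have "bd D X p = (\<Sum>l\<in>{a..<D}. sphere_chain D L a (\<theta>(l := bd1 (\<theta> l))) p)"
        unfolding X_def using a by (intro bd_sphere_chain[OF L]) auto
      also have "\<dots> = (\<Sum>l\<in>insert k {a..<k}. sphere_chain D L a (\<theta>(l := bd1 (\<theta> l))) p)"
      proof (rule sum.mono_neutral_right)
        show "\<forall>l\<in>{a..<D} - insert k {a..<k}. sphere_chain D L a (\<theta>(l := bd1 (\<theta> l))) p = 0"
        proof
          fix l assume "l \<in> {a..<D} - insert k {a..<k}"
          then show "sphere_chain D L a (\<theta>(l := bd1 (\<theta> l))) p = 0"
            by (intro sphere_chain_zero[of a l]) (auto simp: \<theta>_def \<psi>_def k_def bd1_cells[OF L])
        qed
      qed (use k in auto)
      also have "\<dots> = sphere_chain D L a (\<theta>(k := bd1 (\<theta> k))) p + (\<Sum>l\<in>{a..<k}. sphere_chain D L a (\<theta>(l := bd1 (\<theta> l))) p)"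
        by simp
      also have "(\<Sum>l\<in>{a..<k}. sphere_chain D L a (\<theta>(l := bd1 (\<theta> l))) p) =
         (\<Sum>l\<in>{a..<k}. sphere_chain D L a (\<theta>(l := ends_cell L)) p)"
        by (intro sum.cong refl) (auto simp: \<theta>_def \<psi>_def k_def bd1_cells[OF L])
      also have "bd1 (\<theta> k) = (\<lambda>t. zero_cell t + top_cell L t)" by (simp add: \<theta>_def bd1_cells[OF L])
      also have "sphere_chain D L a (\<theta>(k := (\<lambda>t. zero_cell t + top_cell L t))) p =
        sphere_chain D L a (\<theta>(k := zero_cell)) p + sphere_chain D L a (\<theta>(k := top_cell L)) p"
        by (rule sphere_chain_add[OF k])
      also have "\<theta>(k := zero_cell) = \<psi> c" by (auto simp: \<theta>_def \<psi>_def k_def fun_eq_iff)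
      finally show ?thesis by (simp only: add.assoc)
    qed
    then have "bd D X = (\<lambda>p. sphere_chain D L a (\<psi> c) p + (sphere_chain D L a (\<theta>(k := top_cell L)) p +
        (\<Sum>l\<in>{a..<k}. sphere_chain D L a (\<theta>(l := ends_cell L)) p)))" by blast
    then have "P (a - 1 + c) (bd D X) = P (a - 1 + c) (sphere_chain D L a (\<psi> c)) +
        (P (a - 1 + c) (sphere_chain D L a (\<theta>(k := top_cell L))) +
        (\<Sum>l\<in>{a..<k}. P (a - 1 + c) (sphere_chain D L a (\<theta>(l := ends_cell L)))))"
      by (simp add: P_add P_sum)
    also have "P (a - 1 + c) (sphere_chain D L a (\<theta>(k := top_cell L))) = 0"
      by (rule P_sym[OF k]) (use \<theta>_le cells_le(3) in \<open>fastforce split: if_splits\<close>)+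
    also have "(\<Sum>l\<in>{a..<k}. P (a - 1 + c) (sphere_chain D L a (\<theta>(l := ends_cell L)))) = 0"
    proof (rule sum.neutral, rule ballI)
      fix l assume l: "l \<in> {a..<k}"
      show "P (a - 1 + c) (sphere_chain D L a (\<theta>(l := ends_cell L))) = 0"
        by (rule P_sym[of l]) (use l k \<theta>_le cells_le(4) in \<open>fastforce split: if_splits\<close>)+
    qed
    finally show ?case using 1 Suc by simp
  qed
  \<comment> \<open>Now all directions are used and the chain has dimension D - 1. The sign of index
    D - 1 enters only as a factor of the pairing; the D - 1 sign changes come from the
    weight.\<close>
  have "P (D - 1) (sphere_chain D L a (\<psi> (D - a))) = 1"
    using phase2[of "D - a"] a by simp
  then obtain p where p: "sphere_chain D L a (\<psi> (D - a)) p * (g (D - 1) p * weight D g (D - 1) p) \<noteq> 0"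
    unfolding P_def using sum.not_neutral_contains_not_neutral by (metis (no_types, lifting) zero_neq_one)
  have "p \<in> K"
    by (rule in_K) (use p cells_le(1,5) in \<open>auto simp: \<psi>_def split: if_splits\<close>)
  moreover have "weight D g (D - 1) p \<noteq> 0" using p by auto
  ultimately obtain c where "\<forall>r\<le>D-1. c r \<in> K" "\<forall>r<D-1. g r (c r) \<noteq> g r (c (Suc r)) \<and> (\<forall>i. \<bar>c (Suc r) i - c r i\<bar> \<le> 1)"
    using weight_chain[OF K(1)] by blast
  moreover have "r < D \<longleftrightarrow> r \<le> D - 1" for r using a by auto
  ultimately show ?thesis by blast
qed

section \<open>From grids to continuous functions\<close>

text \<open>The boundary of an \<open>a\<close>-dimensional cube times a cube. Functions on
  \<open>nat\<close> are used because \<open>a\<close> and \<open>D\<close> are numbers, not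
  types.\<close>

definition sphere_cube :: "nat \<Rightarrow> nat \<Rightarrow> (nat \<Rightarrow> real) set" where
  "sphere_cube D a = {p. (\<forall>i<D. \<bar>p i\<bar> \<le> 1) \<and> (\<forall>i\<ge>D. p i = 0) \<and> (\<exists>i<a. \<bar>p i\<bar> = 1)}"

lemma compact_sphere_cube: "compact (sphere_cube D a)"
proof -
  let ?S = "\<lambda>i. if i < D then {-1..1} else {0::real}"
  have "compactin (product_topology (\<lambda>_. euclidean) UNIV) (PiE UNIV ?S)"
    by (subst compactin_PiE) (auto simp: compactin_euclidean_iff)
  then have "compact (PiE UNIV ?S)"
    by (simp add: euclidean_product_topology compactin_euclidean_iff)
  moreover have "closed (\<Union>i<a. {p::nat \<Rightarrow> real. \<bar>p i\<bar> = 1})"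
    by (intro closed_UN finite_lessThan ballI closed_Collect_eq continuous_intros) auto
  ultimately have "compact (PiE UNIV ?S \<inter> (\<Union>i<a. {p. \<bar>p i\<bar> = 1}))"
    by (rule compact_Int_closed)
  also have "PiE UNIV ?S \<inter> (\<Union>i<a. {p. \<bar>p i\<bar> = 1}) = sphere_cube D a"
    by (auto simp: sphere_cube_def PiE_UNIV_domain Pi_iff abs_le_iff split: if_splits)
  finally show ?thesis .
qed

lemma tendsto_fun_coordinatewise:
  fixes f :: "'c \<Rightarrow> 'i \<Rightarrow> 'a::topological_space"
  assumes "\<And>i. ((\<lambda>x. f x i) \<longlongrightarrow> l i) F"
  shows "(f \<longlongrightarrow> l) F"
proof -
  have "limitin (product_topology (\<lambda>_. euclidean) UNIV) f l F"
    using assms by (simp add: limitin_componentwise limitin_canonical_iff)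
  then show ?thesis
    by (simp add: euclidean_product_topology limitin_canonical_iff)
qed

lemma tendsto_fun_coordinate:
  fixes f :: "'c \<Rightarrow> 'i \<Rightarrow> 'a::topological_space"
  assumes "(f \<longlongrightarrow> l) F"
  shows "((\<lambda>x. f x i) \<longlongrightarrow> l i) F"
  using continuous_on_tendsto_compose[OF continuous_on_product_coordinates assms, of i] by simp

text \<open>On ever finer grids \<open>antisymmetric_signs_chain\<close> gives chains of
  neighbouring points in which \<open>F r\<close> weakly changes sign between the points of index
  \<open>r\<close> and \<open>Suc r\<close>. Along a subsequence the chains collapse to a single
  point, where continuity makes all these functions vanish.\<close>

theorem common_zero_sphere_cube:
  fixes F :: "nat \<Rightarrow> (nat \<Rightarrow> real) \<Rightarrow> real"
  assumes a: "0 < a" "a \<le> D"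
    and cont: "\<And>r. r < D - 1 \<Longrightarrow> continuous_on (sphere_cube D a) (F r)"
    and odd: "\<And>r p. r < D - 1 \<Longrightarrow> p \<in> sphere_cube D a \<Longrightarrow> F r (\<lambda>i. - p i) = - F r p"
    and sym: "\<And>r p. r < D - 1 \<Longrightarrow> p \<in> sphere_cube D a \<Longrightarrow> \<exists>l\<in>{a..<D}. \<bar>p l\<bar> = 1 \<Longrightarrow>
      F r (\<lambda>i. if i < a then - p i else p i) = F r p"
  shows "\<exists>p\<in>sphere_cube D a. \<forall>r<D-1. F r p = 0"
proof -
  have "\<exists>y. (\<forall>r<D. y r \<in> sphere_cube D a) \<and> (\<forall>r<D-1. F r (y r) * F r (y (Suc r)) \<le> 0 \<and>
      (\<forall>i. \<bar>y (Suc r) i - y r i\<bar> \<le> 1 / real (Suc s)))" for s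
  proof -
    \<comment> \<open>Even, as the grid demands, and large enough that a grid step is at most 1 / (s
      + 1).\<close>
    define L where "L = 2 * int (Suc s)"
    have L: "even L" "0 < L" by (auto simp: L_def)
    let ?K = "{p \<in> grid D L. \<exists>i<a. \<bar>p i\<bar> = L}"
    define x where "x p i = real_of_int (p i) / real_of_int L" for p :: "nat \<Rightarrow> int" and i :: nat
    \<comment> \<open>The combinatorial lemma asks for antisymmetric signs at every index; where no
      function is given, the zero function leaves the sign to the tie-breaking coordinate.\<close>
    define F' where "F' r = (if r < D - 1 then F r else (\<lambda>_. 0))" for r
    \<comment> \<open>A coordinate whose sign breaks ties where F vanishes, respecting both symmetries.\<close>
    define lead where "lead p = (if \<exists>l\<in>{a..<D}. \<bar>p l\<bar> = L then LEAST l. l \<in> {a..<D} \<and> \<bar>p l\<bar> = L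
       else LEAST i. i < a \<and> \<bar>p i\<bar> = L)" for p :: "nat \<Rightarrow> int"
    define g where "g r p = (of_bool (F' r (x p) > 0 \<or> F' r (x p) = 0 \<and> p (lead p) > 0) :: bit)" for r p
    have x_abs1: "\<bar>x p i\<bar> = 1" if "\<bar>p i\<bar> = L" for p i
    proof -
      have "\<bar>real_of_int (p i)\<bar> = real_of_int L" using that by (metis of_int_abs)
      then show ?thesis using L(2) by (simp add: x_def abs_divide)
    qed
    have x_in: "x p \<in> sphere_cube D a" if "p \<in> ?K" for p
    proof -
      have "\<bar>x p i\<bar> \<le> 1" if "i < D" for i
      proof -
        have "\<bar>p i\<bar> \<le> L" using that \<open>p \<in> ?K\<close> by (auto simp: grid_def)
        then have "\<bar>real_of_int (p i)\<bar> \<le> real_of_int L" by linarith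
        then show ?thesis using L(2) by (simp add: x_def abs_divide)
      qed
      moreover have "x p i = 0" if "i \<ge> D" for i
        using that \<open>p \<in> ?K\<close> by (auto simp: grid_def x_def)
      ultimately show ?thesis using that x_abs1 unfolding sphere_cube_def by blast
    qed
    have lead_flip: "lead (flip J p) = lead p" for J p by (simp add: lead_def)
    have lead_y: "lead p \<in> {a..<D}" if "\<exists>l\<in>{a..<D}. \<bar>p l\<bar> = L" for p
    proof -
      have "lead p \<in> {a..<D} \<and> \<bar>p (lead p)\<bar> = L"
        using that unfolding lead_def by (simp only: if_True) (rule LeastI_ex, blast)
      then show ?thesis ..
    qed
    have lead_ne: "p (lead p) \<noteq> 0" if "p \<in> ?K" for p
    proof -
      have "\<bar>p (lead p)\<bar> = L"
      proof (cases "\<exists>l\<in>{a..<D}. \<bar>p l\<bar> = L")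
        case True
        then have "lead p \<in> {a..<D} \<and> \<bar>p (lead p)\<bar> = L"
          unfolding lead_def by (simp only: if_True) (rule LeastI_ex, blast)
        then show ?thesis ..
      next
        case False
        have "\<exists>i. i < a \<and> \<bar>p i\<bar> = L" using that by blast
        then have "(LEAST i. i < a \<and> \<bar>p i\<bar> = L) < a \<and> \<bar>p (LEAST i. i < a \<and> \<bar>p i\<bar> = L)\<bar> = L"
          by (rule LeastI_ex)
        then show ?thesis using False by (simp add: lead_def)
      qed
      then show ?thesis using L(2) by auto
    qed
    have g_anti: "g r (flip UNIV p) = g r p + 1" if p: "p \<in> ?K" for r p
    proof -
      have "x (flip UNIV p) = (\<lambda>i. - x p i)" by (simp add: x_def flip_apply fun_eq_iff)
      then have "F' r (x (flip UNIV p)) = - F' r (x p)" using odd[OF _ x_in[OF p]] by (simp add: F'_def)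
      then show ?thesis using lead_ne[OF p] by (auto simp: g_def lead_flip flip_apply)
    qed
    have g_sym: "g r (flip {..<a} p) = g r p" if p: "p \<in> ?K" and l: "\<exists>l\<in>{a..<D}. \<bar>p l\<bar> = L" for r p
    proof -
      have "x (flip {..<a} p) = (\<lambda>i. if i < a then - x p i else x p i)" by (simp add: x_def flip_apply fun_eq_iff)
      moreover have "\<exists>l\<in>{a..<D}. \<bar>x p l\<bar> = 1" using l x_abs1 by blast
      ultimately have "F' r (x (flip {..<a} p)) = F' r (x p)" using sym[OF _ x_in[OF p]] by (simp add: F'_def)
      moreover have "\<not> lead p < a" using lead_y[OF l] by simp
      ultimately show ?thesis by (simp add: g_def lead_flip flip_apply)
    qed
    obtain c where c: "\<forall>r<D. c r \<in> ?K"
      "\<forall>r<D-1. g r (c r) \<noteq> g r (c (Suc r)) \<and> (\<forall>i. \<bar>c (Suc r) i - c r i\<bar> \<le> 1)"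
      using antisymmetric_signs_chain[OF L a, of g] g_anti g_sym by blast
    show ?thesis
    proof (intro exI[of _ "\<lambda>r. x (c r)"] conjI allI impI)
      fix r assume r: "r < D"
      show "x (c r) \<in> sphere_cube D a" using c(1) r x_in by blast
    next
      fix r assume r: "r < D - 1"
      then have "g r (c r) \<noteq> g r (c (Suc r))" using c(2) by blast
      then have "F r (x (c r)) \<ge> 0 \<and> F r (x (c (Suc r))) \<le> 0 \<or> F r (x (c r)) \<le> 0 \<and> F r (x (c (Suc r))) \<ge> 0"
        using r unfolding g_def F'_def by (auto split: if_splits)
      then show "F r (x (c r)) * F r (x (c (Suc r))) \<le> 0" by (auto simp: mult_le_0_iff)
    next
      fix r i assume r: "r < D - 1"
      then have "\<bar>c (Suc r) i - c r i\<bar> \<le> 1" using c(2) by blast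
      then have "\<bar>real_of_int (c (Suc r) i) - real_of_int (c r i)\<bar> \<le> 1" by linarith
      then have "\<bar>x (c (Suc r)) i - x (c r) i\<bar> \<le> 1 / real_of_int L"
        using L(2) by (simp add: x_def abs_divide flip: diff_divide_distrib) (simp add: divide_right_mono)
      also have "\<dots> \<le> 1 / real (Suc s)" by (simp add: L_def frac_le)
      finally show "\<bar>x (c (Suc r)) i - x (c r) i\<bar> \<le> 1 / real (Suc s)" .
    qed
  qed
  then obtain y where y: "\<And>s r. r < D \<Longrightarrow> y s r \<in> sphere_cube D a"
    "\<And>s r. r < D - 1 \<Longrightarrow> F r (y s r) * F r (y s (Suc r)) \<le> 0"
    "\<And>s r i. r < D - 1 \<Longrightarrow> \<bar>y s (Suc r) i - y s r i\<bar> \<le> 1 / real (Suc s)"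
    by metis
  have "seq_compact (sphere_cube D a)"
    using compact_sphere_cube by (simp add: compact_eq_seq_compact_metric)
  moreover have "\<forall>s. y s 0 \<in> sphere_cube D a" using y(1) a by simp
  ultimately obtain P \<phi> where P: "P \<in> sphere_cube D a" "strict_mono \<phi>" "((\<lambda>s. y s 0) \<circ> \<phi>) \<longlonglongrightarrow> P"
    unfolding seq_compact_def by metis
  \<comment> \<open>Consecutive points differ by at most 1 / (s + 1) in each coordinate, so every
    index inherits the limit of index 0.\<close>
  have lim: "(\<lambda>s. y (\<phi> s) r) \<longlonglongrightarrow> P" if "r < D" for r
    using that
  proof (induction r)
    case 0
    then show ?case using P(3) by (simp add: o_def)
  next
    case (Suc r)
    show ?case
    proof (rule tendsto_fun_coordinatewise)
      fix i
      have "(\<lambda>s. 1 / real (Suc (\<phi> s))) \<longlonglongrightarrow> 0"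
        using LIMSEQ_subseq_LIMSEQ[OF LIMSEQ_Suc[OF lim_1_over_n] P(2)] by (simp add: o_def)
      then have "(\<lambda>s. y (\<phi> s) (Suc r) i - y (\<phi> s) r i) \<longlonglongrightarrow> 0"
        by (rule Lim_null_comparison[rotated]) (use y(3) Suc.prems in auto)
      from tendsto_add[OF this tendsto_fun_coordinate[of _ _ _ i, OF Suc.IH]] Suc.prems
      show "(\<lambda>s. y (\<phi> s) (Suc r) i) \<longlonglongrightarrow> P i" by simp
    qed
  qed
  have "F r P = 0" if r: "r < D - 1" for r
  proof -
    have F: "(\<lambda>s. F r (y (\<phi> s) q)) \<longlonglongrightarrow> F r P" if "q < D" for q
      by (rule continuous_on_tendsto_compose[OF cont[OF r] lim[OF that] P(1)])
         (use y(1) that in auto)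
    \<comment> \<open>Both factors tend to \<open>F r P\<close>, so the nonpositive products tend to
      a square.\<close>
    have "(\<lambda>s. F r (y (\<phi> s) r) * F r (y (\<phi> s) (Suc r))) \<longlonglongrightarrow> F r P * F r P"
      using r by (intro tendsto_mult F) auto
    then have "F r P * F r P \<le> 0"
      by (rule tendsto_upperbound) (use y(2)[OF r] in auto)
    then show ?thesis by (auto simp: mult_le_0_iff)
  qed
  with P(1) show ?thesis by blast
qed

section \<open>Masses, quadratic functions and subspaces\<close>

text \<open>One family covers spheres (c nonzero) and hyperplanes (c zero). It is linear in its
  parameters, so negating them all negates the function.\<close>

definition quad :: "'a::euclidean_space \<Rightarrow> real \<Rightarrow> real \<Rightarrow> 'a \<Rightarrow> real" where
  "quad w b c x = w \<bullet> x + b + c * (x \<bullet> x)"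

lemma continuous_on_quad [continuous_intros]: "continuous_on S (quad w b c)"
  unfolding quad_def[abs_def] by (intro continuous_intros)

lemma borel_measurable_quad [measurable]: "quad w b c \<in> borel_measurable borel"
  by (intro borel_measurable_continuous_onI continuous_intros)

section \<open>Integrals of signs under weak convergence\<close>

text \<open>The sign of \<open>q\<close> is discontinuous only at zeros of \<open>q\<close>, a null
  set for the limit measure. A continuous truncation \<phi> replaces all the signs at a cost of
  twice the integral of a continuous cutoff \<xi>, which weak convergence controls for
  \<open>Mn n\<close> as well.\<close>

lemma tendsto_integral_sgn:
  fixes q :: "'a::euclidean_space \<Rightarrow> real"
  assumes M: "finite_measure M" "sets M = sets borel"
    and Mn: "\<And>n. finite_measure (Mn n)" "\<And>n. sets (Mn n) = sets borel"
    and weak: "\<And>f :: 'a \<Rightarrow> real. continuous_on UNIV f \<Longrightarrow> bounded (range f) \<Longrightarrow>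
       (\<lambda>n. integral\<^sup>L (Mn n) f) \<longlonglongrightarrow> integral\<^sup>L M f"
    and q: "continuous_on UNIV q" "\<And>n. continuous_on UNIV (qn n)"
    and conv: "\<And>R e. e > 0 \<Longrightarrow> \<forall>\<^sub>F n in sequentially. \<forall>x. norm x \<le> R \<longrightarrow> \<bar>qn n x - q x\<bar> < e"
    and null: "emeasure M {x. q x = 0} = 0"
  shows "(\<lambda>n. \<integral>x. sgn (qn n x) \<partial>Mn n) \<longlonglongrightarrow> (\<integral>x. sgn (q x) \<partial>M)"
proof (rule tendstoI)
  fix e :: real assume e: "e > 0"
  have q_meas [measurable]: "q \<in> borel_measurable borel" "\<And>n. qn n \<in> borel_measurable borel"
    using q by (auto intro: borel_measurable_continuous_onI)
  have int: "integrable N f" if "finite_measure N" "sets N = sets borel" "f \<in> borel_measurable borel"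
    "\<And>x. \<bar>f x\<bar> \<le> 2" for N :: "'a measure" and f :: "'a \<Rightarrow> real"
    by (rule finite_measure.integrable_const_bound[OF that(1), of _ 2])
       (use that in \<open>auto simp: measurable_cong_sets[OF that(2) refl]\<close>)
  \<comment> \<open>A continuous function of small integral that is 1 near the zeros of q and near infinity;
    elsewhere the sign of q is stable under the perturbation.\<close>
  define \<xi> where "\<xi> j x = max (max 0 (min 1 (2 - real (Suc j) * \<bar>q x\<bar>))) (max 0 (min 1 (norm x - real (Suc j))))" for j x
  have \<xi>_cont: "continuous_on UNIV (\<xi> j)" for j
    unfolding \<xi>_def[abs_def] by (intro continuous_intros q)
  then have \<xi>_meas [measurable]: "\<xi> j \<in> borel_measurable borel" for j
    by (rule borel_measurable_continuous_onI)
  have \<xi>_bd: "0 \<le> \<xi> j x" "\<xi> j x \<le> 1" for j x by (auto simp: \<xi>_def)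
  have "(\<lambda>j. integral\<^sup>L M (\<xi> j)) \<longlonglongrightarrow> integral\<^sup>L M (\<lambda>x. 0)"
  proof (rule integral_dominated_convergence[where w = "\<lambda>_. 1"])
    show "integrable M (\<lambda>_. 1::real)" by (rule finite_measure.integrable_const[OF M(1)])
    have "AE x in M. q x \<noteq> 0"
      using null M(2) by (intro AE_I[of _ _ "{x. q x = 0}"]) (auto simp: sets_eq_imp_space_eq[OF M(2)])
    moreover have "(\<lambda>j. \<xi> j x) \<longlonglongrightarrow> 0" if "q x \<noteq> 0" for x
    proof (rule tendsto_eventually)
      obtain N where N: "real N > norm x" "real N > 2 / \<bar>q x\<bar>"
        using reals_Archimedean2[of "max (norm x) (2 / \<bar>q x\<bar>)"] by auto
      have "\<xi> j x = 0" if "j \<ge> N" for j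
      proof -
        have "real (Suc j) \<ge> real N" using that by simp
        then have "real (Suc j) > norm x" "real (Suc j) > 2 / \<bar>q x\<bar>" using N by linarith+
        then have "real (Suc j) > norm x" "real (Suc j) * \<bar>q x\<bar> > 2"
          using \<open>q x \<noteq> 0\<close> by (simp_all add: field_simps)
        then show ?thesis by (simp add: \<xi>_def)
      qed
      then show "\<forall>\<^sub>F j in sequentially. \<xi> j x = 0" by (auto simp: eventually_sequentially)
    qed
    ultimately show "AE x in M. (\<lambda>j. \<xi> j x) \<longlonglongrightarrow> 0" by (auto elim: eventually_mono)
    show "AE x in M. norm (\<xi> j x) \<le> 1" for j using \<xi>_bd by simp
  qed (simp_all add: measurable_cong_sets[OF M(2) refl])
  then have "\<forall>\<^sub>F j in sequentially. integral\<^sup>L M (\<xi> j) < e / 8"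
    by (rule order_tendstoD) (use e in simp)
  \<comment> \<open>With this \<open>j\<close> the total error stays below 2e/8 + e/8 +
    2e/8.\<close>
  then obtain j where j: "integral\<^sup>L M (\<xi> j) < e / 8" by (auto simp: eventually_sequentially)
  define \<phi> where "\<phi> x = max (-1) (min 1 (real (Suc j) * q x))" for x
  have \<phi>_cont: "continuous_on UNIV \<phi>"
    unfolding \<phi>_def[abs_def] by (intro continuous_intros q)
  then have \<phi>_meas [measurable]: "\<phi> \<in> borel_measurable borel"
    by (rule borel_measurable_continuous_onI)
  have \<phi>_bd: "\<bar>\<phi> x\<bar> \<le> 1" for x by (auto simp: \<phi>_def)
  have sgn_bd: "\<bar>sgn t\<bar> \<le> 1" for t :: real by (simp add: sgn_if)
  have \<phi>_sgn: "\<phi> x = sgn (q x)" if "\<xi> j x < 1" for x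
  proof -
    have "real (Suc j) * \<bar>q x\<bar> > 1" using that by (auto simp: \<xi>_def max_def min_def split: if_splits)
    then show ?thesis by (cases "q x > 0") (auto simp: \<phi>_def sgn_if max_def min_def)
  qed
  have close: "\<bar>sgn (r x) - \<phi> x\<bar> \<le> 2 * \<xi> j x" if "\<xi> j x < 1 \<Longrightarrow> sgn (r x) = sgn (q x)" for r and x :: 'a
  proof (cases "\<xi> j x < 1")
    case True
    then show ?thesis using that \<phi>_sgn \<xi>_bd(1)[of j x] by simp
  next
    case False
    then have "\<xi> j x = 1" using \<xi>_bd(2)[of j x] by simp
    then show ?thesis using sgn_bd[of "r x"] \<phi>_bd[of x] by linarith
  qed
  have close_int: "\<bar>(\<integral>x. sgn (r x) \<partial>N) - integral\<^sup>L N \<phi>\<bar> \<le> 2 * integral\<^sup>L N (\<xi> j)"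
    if N: "finite_measure N" "sets N = sets borel" and r [measurable]: "r \<in> borel_measurable borel"
      and eq: "\<And>x. \<xi> j x < 1 \<Longrightarrow> sgn (r x) = sgn (q x)" for N r
  proof -
    have i: "integrable N (\<lambda>x. sgn (r x))" "integrable N \<phi>" "integrable N (\<xi> j)"
    proof -
      show "integrable N (\<lambda>x. sgn (r x))"
        by (rule int[OF N _ order_trans[OF sgn_bd]]) simp_all
      show "integrable N \<phi>"
        by (rule int[OF N _ order_trans[OF \<phi>_bd]]) simp_all
      have "\<bar>\<xi> j x\<bar> \<le> 2" for x using \<xi>_bd[of j x] by simp
      then show "integrable N (\<xi> j)"
        by (rule int[OF N, rotated]) simp
    qed
    have "\<bar>(\<integral>x. sgn (r x) \<partial>N) - integral\<^sup>L N \<phi>\<bar> = \<bar>\<integral>x. sgn (r x) - \<phi> x \<partial>N\<bar>"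
      using i by simp
    also have "\<dots> \<le> (\<integral>x. \<bar>sgn (r x) - \<phi> x\<bar> \<partial>N)" by (rule integral_abs_bound)
    also have "\<dots> \<le> (\<integral>x. 2 * \<xi> j x \<partial>N)"
      by (rule integral_mono) (use i close eq in auto)
    also have "\<dots> = 2 * integral\<^sup>L N (\<xi> j)" by simp
    finally show ?thesis .
  qed
  have "(\<lambda>n. integral\<^sup>L (Mn n) (\<xi> j)) \<longlonglongrightarrow> integral\<^sup>L M (\<xi> j)"
    by (intro weak \<xi>_cont boundedI[of _ 1]) (use \<xi>_bd in auto)
  then have ev1: "\<forall>\<^sub>F n in sequentially. integral\<^sup>L (Mn n) (\<xi> j) < e / 8"
    using j by (rule order_tendstoD)
  have "(\<lambda>n. integral\<^sup>L (Mn n) \<phi>) \<longlonglongrightarrow> integral\<^sup>L M \<phi>"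
    by (intro weak \<phi>_cont boundedI[of _ 1]) (use \<phi>_bd in auto)
  then have ev2: "\<forall>\<^sub>F n in sequentially. dist (integral\<^sup>L (Mn n) \<phi>) (integral\<^sup>L M \<phi>) < e / 8"
    by (rule tendstoD) (use e in simp)
  \<comment> \<open>Where \<xi> j is below 1, the point lies in the ball of radius j + 2 and |q|
    exceeds 1 / (j + 1), so this perturbation cannot change the sign.\<close>
  have ev3: "\<forall>\<^sub>F n in sequentially. \<forall>x. norm x \<le> real (Suc j) + 1 \<longrightarrow> \<bar>qn n x - q x\<bar> < 1 / real (Suc j)"
    by (rule conv) simp
  show "\<forall>\<^sub>F n in sequentially. dist (\<integral>x. sgn (qn n x) \<partial>Mn n) (\<integral>x. sgn (q x) \<partial>M) < e"
    using ev1 ev2 ev3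
  proof eventually_elim
    case (elim n)
    have "sgn (qn n x) = sgn (q x)" if "\<xi> j x < 1" for x
    proof -
      have "real (Suc j) * \<bar>q x\<bar> > 1" "norm x \<le> real (Suc j) + 1"
        using that by (auto simp: \<xi>_def max_def min_def split: if_splits)
      then have "\<bar>q x\<bar> > 1 / real (Suc j)" "\<bar>qn n x - q x\<bar> < 1 / real (Suc j)"
        using elim(3) by (auto simp: field_simps)
      then have "\<bar>qn n x - q x\<bar> < \<bar>q x\<bar>" by linarith
      then show ?thesis by (auto simp: sgn_if)
    qed
    then have "\<bar>(\<integral>x. sgn (qn n x) \<partial>Mn n) - integral\<^sup>L (Mn n) \<phi>\<bar> \<le> 2 * integral\<^sup>L (Mn n) (\<xi> j)"
      by (intro close_int[OF Mn]) auto
    moreover have "\<bar>(\<integral>x. sgn (q x) \<partial>M) - integral\<^sup>L M \<phi>\<bar> \<le> 2 * integral\<^sup>L M (\<xi> j)"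
      by (intro close_int[OF M]) auto
    ultimately show ?case using elim(1,2) j e unfolding dist_real_def by linarith
  qed
qed

lemma quad_tendsto_uniform_on_balls:
  fixes w :: "'a::euclidean_space"
  assumes "wn \<longlonglongrightarrow> w" "bn \<longlonglongrightarrow> b" "cn \<longlonglongrightarrow> c" "e > 0"
  shows "\<forall>\<^sub>F n in sequentially. \<forall>x. norm x \<le> R \<longrightarrow> \<bar>quad (wn n) (bn n) (cn n) x - quad w b c x\<bar> < e"
proof -
  have "(\<lambda>n. norm (wn n - w) * \<bar>R\<bar> + \<bar>bn n - b\<bar> + \<bar>cn n - c\<bar> * R\<^sup>2) \<longlonglongrightarrow> norm (w - w) * \<bar>R\<bar> + \<bar>b - b\<bar> + \<bar>c - c\<bar> * R\<^sup>2"
    by (intro tendsto_intros assms)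
  then have "\<forall>\<^sub>F n in sequentially. norm (wn n - w) * \<bar>R\<bar> + \<bar>bn n - b\<bar> + \<bar>cn n - c\<bar> * R\<^sup>2 < e"
    by (rule order_tendstoD) (use assms in simp)
  then show ?thesis
  proof eventually_elim
    case (elim n)
    show ?case
    proof (intro allI impI)
      fix x :: 'a assume x: "norm x \<le> R"
      have "quad (wn n) (bn n) (cn n) x - quad w b c x = (wn n - w) \<bullet> x + (bn n - b) + (cn n - c) * (norm x)\<^sup>2"
        by (simp add: quad_def algebra_simps inner_diff_left power2_norm_eq_inner)
      also have "\<bar>\<dots>\<bar> \<le> \<bar>(wn n - w) \<bullet> x\<bar> + \<bar>bn n - b\<bar> + \<bar>cn n - c\<bar> * (norm x)\<^sup>2"
        using abs_mult[of "cn n - c" "(norm x)\<^sup>2"] by (simp only: abs_power2; linarith)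
      also have "\<dots> \<le> norm (wn n - w) * \<bar>R\<bar> + \<bar>bn n - b\<bar> + \<bar>cn n - c\<bar> * R\<^sup>2"
      proof (intro add_mono mult_left_mono order_refl)
        have "\<bar>(wn n - w) \<bullet> x\<bar> \<le> norm (wn n - w) * norm x" by (rule Cauchy_Schwarz_ineq2)
        also have "\<dots> \<le> norm (wn n - w) * \<bar>R\<bar>" using x by (intro mult_left_mono) auto
        finally show "\<bar>(wn n - w) \<bullet> x\<bar> \<le> norm (wn n - w) * \<bar>R\<bar>" .
        show "(norm x)\<^sup>2 \<le> R\<^sup>2" using x by (intro power_mono) auto
      qed auto
      finally show "\<bar>quad (wn n) (bn n) (cn n) x - quad w b c x\<bar> < e" using elim by linarith
    qed
  qed
qed

section \<open>Null sets of mass distributions\<close>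

text \<open>On a segment the value is the interpolated value minus \<open>c * u * v\<close> times
  the squared distance of the ends.\<close>

lemma convex_quad_sublevel: "0 \<le> c \<Longrightarrow> convex {x. quad w b c x \<le> 0}"
proof -
  assume c: "0 \<le> c"
  show ?thesis
  proof (rule convexI)
    fix x y :: 'a and u v :: real
    assume xy: "x \<in> {x. quad w b c x \<le> 0}" "y \<in> {x. quad w b c x \<le> 0}" and uv: "0 \<le> u" "0 \<le> v" "u + v = 1"
    have v: "v = 1 - u" using uv by simp
    have "quad w b c (u *\<^sub>R x + v *\<^sub>R y) = u * quad w b c x + v * quad w b c y - c * (u * v * ((x - y) \<bullet> (x - y)))"
      unfolding v quad_def
      by (simp add: inner_add_left inner_add_right inner_diff_left inner_diff_right inner_commute algebra_simps)
    also have "\<dots> \<le> 0"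
    proof -
      have "u * quad w b c x \<le> 0" "v * quad w b c y \<le> 0" using xy uv by (auto simp: mult_nonneg_nonpos)
      moreover have "0 \<le> c * (u * v * ((x - y) \<bullet> (x - y)))" using c uv by simp
      ultimately show ?thesis by linarith
    qed
    finally show "u *\<^sub>R x + v *\<^sub>R y \<in> {x. quad w b c x \<le> 0}" by simp
  qed
qed

lemma quad_minus: "quad (- w) (- b) (- c) x = - quad w b c x"
  by (simp add: quad_def)

text \<open>For nonnegative \<open>c\<close> the zeros lie on the frontier of a convex sublevel set,
  and such a frontier is negligible. As \<open>w\<close> lies in the range, it is itself an
  available direction in which the affine function varies.\<close>

lemma negligible_quad_zeros:
  fixes g :: "'b::euclidean_space \<Rightarrow> 'a::euclidean_space"
  assumes g: "linear g" "inj g" and w: "w \<in> range g" and nz: "w \<noteq> 0 \<or> b \<noteq> 0 \<or> c \<noteq> 0"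
  shows "negligible {y. quad w b c (g y) = 0}"
proof -
  have *: "negligible {y. quad w b c (g y) = 0}"
    if c: "0 \<le> c" and w: "w \<in> range g" and nz: "w \<noteq> 0 \<or> b \<noteq> 0 \<or> c \<noteq> 0" for w b c
  proof -
    let ?S = "{y. quad w b c (g y) \<le> 0}"
    have "?S = g -` {x. quad w b c x \<le> 0}" by auto
    then have "convex ?S" using convex_linear_vimage[OF g(1) convex_quad_sublevel[OF c]] by simp
    then have "negligible (frontier ?S)" by (rule negligible_convex_frontier)
    moreover have "{y. quad w b c (g y) = 0} \<subseteq> frontier ?S"
    proof
      fix y assume y: "y \<in> {y. quad w b c (g y) = 0}"
      have "y \<notin> interior ?S"
      proof
        assume "y \<in> interior ?S"
        then obtain r where r: "r > 0" "ball y r \<subseteq> ?S" by (auto simp: mem_interior)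
        \<comment> \<open>At a zero the linear terms of opposite displacements cancel. Inside the
          sublevel set both values are nonpositive, which excludes c > 0.\<close>
        have sum: "quad w b c (g (y + z)) + quad w b c (g (y - z)) = 2 * c * (g z \<bullet> g z)" for z
          using y by (simp add: quad_def linear_add[OF g(1)] linear_diff[OF g(1)] inner_add_left inner_add_right
              inner_diff_left inner_diff_right inner_commute algebra_simps)
        have le: "quad w b c (g (y + z)) \<le> 0" if "norm z < r" for z
        proof -
          have "y + z \<in> ball y r" using that by (simp add: dist_norm)
          then show ?thesis using r by blast
        qed
        have small: "\<exists>s>0. norm (s *\<^sub>R z) < r" for z :: 'b
        proof -
          define s where "s = r / (norm z + 1)"
          have "norm z + 1 > 0" by (simp add: add_nonneg_pos)
          then have "s > 0" "s * norm z < r"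
            using r(1) by (auto simp: s_def field_simps)
          then show ?thesis by (intro exI[of _ s]) simp
        qed
        show False
        proof (cases "c = 0")
          case False
          then have c: "c > 0" using c by simp
          obtain z :: 'b where z: "z \<in> Basis" using nonempty_Basis by blast
          obtain s where s: "s > 0" "norm (s *\<^sub>R z) < r" using small by blast
          have "2 * c * (g (s *\<^sub>R z) \<bullet> g (s *\<^sub>R z)) \<le> 0"
            using sum[of "s *\<^sub>R z"] le[of "s *\<^sub>R z"] le[of "- (s *\<^sub>R z)"] s by simp
          then have "g (s *\<^sub>R z) = 0" using c by (simp add: mult_le_0_iff) (metis inner_gt_zero_iff not_le)
          then have "s *\<^sub>R z = 0" using g linear_injective_0 by blast
          then show False using s z by auto
        next
          case True
          \<comment> \<open>For c = 0, moving along \<open>w\<close> would raise the value above 0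
            unless w = 0; then b = 0 too, against \<open>nz\<close>.\<close>
          obtain x where x: "w = g x" using w by blast
          obtain s where s: "s > 0" "norm (s *\<^sub>R x) < r" using small by blast
          have "quad w b c (g (y + s *\<^sub>R x)) = s * (w \<bullet> w)"
            using y True x by (simp add: quad_def linear_add[OF g(1)] linear_scale[OF g(1)] inner_add_right)
          then have "s * (w \<bullet> w) \<le> 0" using le[OF s(2)] by simp
          then have "w = 0" using s by (simp add: mult_le_0_iff) (metis inner_gt_zero_iff not_le)
          then show False using y nz True by (simp add: quad_def)
        qed
      qed
      then show "y \<in> frontier ?S" using y closure_subset[of ?S] by (auto simp: frontier_def)
    qed
    ultimately show ?thesis by (rule negligible_subset)
  qed
  show ?thesis
  proof (cases "0 \<le> c")
    case False
    have "- w \<in> range g" using w linear_neg[OF g(1)] by (metis imageE rangeI)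
    then have "negligible {y. quad (- w) (- b) (- c) (g y) = 0}" using False nz by (intro *) auto
    then show ?thesis by (simp add: quad_minus)
  qed (use * w nz in auto)
qed

text \<open>Equality of dimensions provides an isometric parametrization of \<open>L\<close>; along
  it \<open>S\<close> pulls back to a Lebesgue null set, and absolute continuity applies.\<close>

lemma mass_distribution_on_null:
  fixes L :: "(real^'n) set"
  assumes m: "mass_distribution_on TYPE('k::finite) L m" and L: "L \<in> grassmannian CARD('k)"
    and S: "S \<in> sets borel"
    and neg: "\<And>g :: real^'k \<Rightarrow> real^'n. linear g \<Longrightarrow> inj g \<Longrightarrow> range g = L \<Longrightarrow> negligible (g -` S)"
  shows "emeasure m S = 0"
proof -
  have "subspace L" "dim (UNIV :: (real^'k) set) = dim L"
    using L by (auto simp: grassmannian_def)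
  then obtain g :: "real^'k \<Rightarrow> real^'n" where g: "linear g" "g ` UNIV = L" "\<And>x. norm (g x) = norm x"
    using isometry_subspaces[of "UNIV :: (real^'k) set" L] by auto
  have inj: "inj g" using g(1,3) by (metis linear_injective_0 norm_eq_zero)
  have gm: "g \<in> borel_measurable borel"
    using g(1) by (intro borel_measurable_continuous_onI linear_continuous_on linear_conv_bounded_linear[THEN iffD1])
  have vS: "g -` S \<in> sets borel" using measurable_sets[OF gm S] by simp
  have "g -` S \<in> null_sets lebesgue" using neg[OF g(1) inj g(2)] by (simp add: negligible_iff_null_sets)
  then have "g -` S \<in> null_sets lborel" using vS by (simp add: null_sets_completion_iff)
  then have "S \<in> null_sets (distr lborel borel g)"
    using S gm by (simp add: null_sets_def emeasure_distr)
  then have "S \<in> null_sets m"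
    using m g inj unfolding mass_distribution_on_def absolutely_continuous_def by blast
  then show ?thesis by (rule null_setsD1)
qed

lemma mass_distribution_on_complement_null:
  fixes L :: "(real^'n) set"
  assumes "mass_distribution_on TYPE('k::finite) L m" "L \<in> grassmannian CARD('k)"
  shows "emeasure m (- L) = 0"
proof (rule mass_distribution_on_null[OF assms])
  have "closed L" using assms by (simp add: grassmannian_def closed_subspace)
  then show "- L \<in> sets borel" by auto
  show "negligible (g -` (- L))" if "range g = L" for g :: "real^'k \<Rightarrow> real^'n"
  proof -
    have "g -` (- L) = {}" using that by auto
    then show ?thesis by simp
  qed
qed

lemma mass_distribution_on_quad_null:
  fixes L :: "(real^'n) set"
  assumes "mass_distribution_on TYPE('k::finite) L m" "L \<in> grassmannian CARD('k)"
    and w: "w \<in> L" and nz: "w \<noteq> 0 \<or> b \<noteq> 0 \<or> c \<noteq> 0"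
  shows "emeasure m {x. quad w b c x = 0} = 0"
proof (rule mass_distribution_on_null[OF assms(1,2)])
  have "{x \<in> space borel. quad w b c x = 0} \<in> sets borel" by measurable
  then show "{x. quad w b c x = 0} \<in> sets borel" by simp
  show "negligible (g -` {x. quad w b c x = 0})" if "linear g" "inj g" "range g = L" for g :: "real^'k \<Rightarrow> real^'n"
    using negligible_quad_zeros[OF that(1,2), of w b c] w nz that(3) by (simp add: vimage_def)
qed

section \<open>Distances between subspaces\<close>

lemma gr_dist_le:
  fixes L M :: "'a::euclidean_space set"
  assumes "0 \<in> L" "0 \<in> M"
    and "\<And>x. x \<in> L \<Longrightarrow> norm x \<le> 1 \<Longrightarrow> \<exists>y\<in>M. norm y \<le> 1 \<and> dist x y \<le> e"
    and "\<And>y. y \<in> M \<Longrightarrow> norm y \<le> 1 \<Longrightarrow> \<exists>x\<in>L. norm x \<le> 1 \<and> dist y x \<le> e"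
  shows "gr_dist L M \<le> e"
proof -
  have *: "(SUP x\<in>A \<inter> cball 0 1. infdist x (B \<inter> cball 0 1)) \<le> e"
    if "0 \<in> A" and near: "\<And>x. x \<in> A \<Longrightarrow> norm x \<le> 1 \<Longrightarrow> \<exists>y\<in>B. norm y \<le> 1 \<and> dist x y \<le> e" for A B :: "'a set"
  proof (rule cSUP_least)
    show "A \<inter> cball 0 1 \<noteq> {}" using that(1) by auto
    fix x assume "x \<in> A \<inter> cball 0 1"
    then obtain y where "y \<in> B" "norm y \<le> 1" "dist x y \<le> e" using near[of x] by auto
    then show "infdist x (B \<inter> cball 0 1) \<le> e" by (intro order_trans[OF infdist_le]) auto
  qed
  show ?thesis unfolding gr_dist_def using assms by (intro max.boundedI *) auto
qed

text \<open>For z in V, replacing z + k v by z + k v' preserves the norm by orthogonality and moves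
  the vector by |k| times the distance of v and v', where |k| is at most 1 in the unit ball.\<close>

lemma gr_dist_span_insert_le:
  fixes V :: "'a::euclidean_space set"
  assumes V: "subspace V" and orth: "\<And>x. x \<in> V \<Longrightarrow> v \<bullet> x = 0" "\<And>x. x \<in> V \<Longrightarrow> v' \<bullet> x = 0"
    and unit: "norm v = 1" "norm v' = 1"
  shows "gr_dist (span (insert v V)) (span (insert v' V)) \<le> norm (v - v')"
proof (rule gr_dist_le)
  have *: "\<exists>y\<in>span (insert t V). norm y \<le> 1 \<and> dist x y \<le> norm (s - t)"
    if x: "x \<in> span (insert s V)" "norm x \<le> 1" and o: "\<And>x. x \<in> V \<Longrightarrow> s \<bullet> x = 0" "\<And>x. x \<in> V \<Longrightarrow> t \<bullet> x = 0"
      and u: "norm s = 1" "norm t = 1" for x s t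
  proof -
    obtain k where k: "x - k *\<^sub>R s \<in> V" using x(1) V by (metis span_breakdown_eq span_eq_iff)
    define z where "z = x - k *\<^sub>R s"
    have z: "z \<in> V" "x = z + k *\<^sub>R s" using k by (auto simp: z_def)
    have nrm: "(norm (z + k *\<^sub>R r))\<^sup>2 = (norm z)\<^sup>2 + k\<^sup>2" if "r \<bullet> z = 0" "norm r = 1" for r
    proof -
      have "r \<bullet> r = 1" using that(2) by (simp add: dot_square_norm)
      then show ?thesis using that(1)
        unfolding power2_norm_eq_inner
        by (simp add: inner_add_left inner_add_right inner_commute power2_eq_square)
    qed
    define y where "y = z + k *\<^sub>R t"
    have ny: "(norm y)\<^sup>2 = (norm x)\<^sup>2" unfolding y_def z(2) using nrm o z(1) u by simp
    then have "norm y = norm x" by (simp add: power2_eq_iff_nonneg)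
    moreover have "\<bar>k\<bar> \<le> 1"
    proof -
      have "k\<^sup>2 \<le> (norm x)\<^sup>2" unfolding z(2) using nrm[of s] o z(1) u by simp
      also have "\<dots> \<le> 1" using x(2) by (simp add: power_le_one)
      finally show ?thesis by (simp add: abs_square_le_1)
    qed
    moreover have "dist x y = \<bar>k\<bar> * norm (s - t)"
      unfolding y_def z(2) dist_norm by (simp add: algebra_simps flip: scaleR_diff_right norm_scaleR)
    moreover have "y \<in> span (insert t V)"
      unfolding y_def by (intro span_add span_scale) (use z(1) in \<open>auto intro: span_base\<close>)
    ultimately show ?thesis
      using x(2) by (intro bexI[of _ y]) (auto simp: mult_left_le_one_le)
  qed
  show "\<exists>y\<in>span (insert v' V). norm y \<le> 1 \<and> dist x y \<le> norm (v - v')"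
    if "x \<in> span (insert v V)" "norm x \<le> 1" for x
    using *[OF that orth unit] .
  show "\<exists>x\<in>span (insert v V). norm x \<le> 1 \<and> dist y x \<le> norm (v - v')"
    if "y \<in> span (insert v' V)" "norm y \<le> 1" for y
    using *[OF that orth(2,1) unit(2,1)] by (simp add: norm_minus_commute)
qed (auto intro: span_0)

lemma span_insert_scale:
  assumes "k \<noteq> 0"
  shows "span (insert (k *\<^sub>R v) V) = span (insert (v::'a::real_vector) V)"
proof -
  have "k *\<^sub>R v \<in> span (insert v V)" by (intro span_scale span_base) auto
  moreover have "v \<in> span (insert (k *\<^sub>R v) V)"
    using span_scale[OF span_base[of "k *\<^sub>R v" "insert (k *\<^sub>R v) V"], of "inverse k"] assms by simp
  moreover have "V \<subseteq> span (insert v V)" "V \<subseteq> span (insert (k *\<^sub>R v) V)" by (auto intro: span_base)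
  ultimately show ?thesis by (simp add: span_eq)
qed

text \<open>The span sees only the direction of the vector, and normalization is continuous away
  from 0.\<close>

lemma gr_dist_span_insert_tendsto:
  fixes V :: "'a::euclidean_space set"
  assumes V: "subspace V" and orth: "\<And>x. x \<in> V \<Longrightarrow> v \<bullet> x = 0" "\<And>n x. x \<in> V \<Longrightarrow> vn n \<bullet> x = 0"
    and nz: "v \<noteq> 0" "\<And>n. vn n \<noteq> 0" and lim: "vn \<longlonglongrightarrow> v" and d: "d > 0"
  shows "\<forall>\<^sub>F n in sequentially. gr_dist (span (insert (vn n) V)) (span (insert v V)) < d"
proof -
  define unit where "unit x = inverse (norm x) *\<^sub>R x" for x :: 'a
  have span_unit: "span (insert (unit x) V) = span (insert x V)" if "x \<noteq> 0" for x
    unfolding unit_def using that by (intro span_insert_scale) simp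
  have "(\<lambda>n. norm (unit (vn n) - unit v)) \<longlonglongrightarrow> norm (unit v - unit v)"
    unfolding unit_def using nz by (intro tendsto_intros lim) auto
  then have "\<forall>\<^sub>F n in sequentially. norm (unit (vn n) - unit v) < d"
    by (rule order_tendstoD) (use d in simp)
  then show ?thesis
  proof eventually_elim
    case (elim n)
    have "gr_dist (span (insert (unit (vn n)) V)) (span (insert (unit v) V)) \<le> norm (unit (vn n) - unit v)"
      by (rule gr_dist_span_insert_le[OF V]) (use orth nz in \<open>auto simp: unit_def\<close>)
    then show ?case using elim nz by (simp add: span_unit)
  qed
qed

text \<open>The index set is free so that two orthogonal subspaces can use disjoint ranges of one
  coordinate vector.\<close>

lemma orthonormal_enumeration:
  fixes S :: "'a::euclidean_space set"
  assumes "subspace S" "finite I" "card I = dim S"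
  shows "\<exists>e :: 'i \<Rightarrow> 'a. (\<forall>i\<in>I. e i \<in> S) \<and> (\<forall>i\<in>I. \<forall>j\<in>I. e i \<bullet> e j = of_bool (i = j))"
proof -
  obtain B where B: "B \<subseteq> S" "pairwise orthogonal B" "\<And>x. x \<in> B \<Longrightarrow> norm x = 1" "independent B" "card B = dim S"
    using orthonormal_basis_subspace[OF assms(1)] by blast
  have "finite B" using B(4) by (rule independent_imp_finite)
  then obtain e where e: "bij_betw e I B"
    using finite_same_card_bij[OF assms(2)] assms(3) B(5) by metis
  show ?thesis
  proof (intro exI[of _ e] conjI ballI)
    fix i assume "i \<in> I"
    then show "e i \<in> S" using e B(1) bij_betwE by blast
  next
    fix i j assume ij: "i \<in> I" "j \<in> I"
    then have eB: "e i \<in> B" "e j \<in> B" using e bij_betwE by blast+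
    show "e i \<bullet> e j = of_bool (i = j)"
    proof (cases "i = j")
      case True
      then show ?thesis using B(3)[OF eB(1)] by (simp add: dot_square_norm)
    next
      case False
      then have "e i \<noteq> e j" using e ij by (auto simp: bij_betw_def inj_on_def)
      then show ?thesis using B(2) eB False by (auto simp: pairwise_def orthogonal_def)
    qed
  qed
qed

section \<open>Halving regions from vanishing integrals\<close>

text \<open>The integral is the measure of the positive side minus that of the negative side, and
  together the two sides carry the whole mass.\<close>

lemma halving_of_integral_sgn:
  fixes q :: "'a::topological_space \<Rightarrow> real"
  assumes m: "finite_measure m" "sets m = sets borel" and q [measurable]: "q \<in> borel_measurable borel"
    and null: "emeasure m {x. q x = 0} = 0" and zero: "(\<integral>x. sgn (q x) \<partial>m) = 0"
  shows "measure m {x. q x < 0} = measure m UNIV / 2" "measure m {x. q x > 0} = measure m UNIV / 2"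
proof -
  interpret finite_measure m by fact
  have sp: "space m = UNIV" using sets_eq_imp_space_eq[OF m(2)] by simp
  have meas: "{x. q x < 0} \<in> sets m" "{x. q x > 0} \<in> sets m" "{x. q x = 0} \<in> sets m"
    using borel_measurable_less[of q borel "\<lambda>_. 0"] borel_measurable_less[of "\<lambda>_. 0" borel q]
      borel_measurable_eq[of q borel "\<lambda>_. 0"] m(2) by (auto simp: pred_def)
  have "(\<integral>x. sgn (q x) \<partial>m) = (\<integral>x. indicator {x. q x > 0} x - indicator {x. q x < 0} x \<partial>m)"
    by (intro Bochner_Integration.integral_cong) (auto simp: sgn_if indicator_def)
  also have "\<dots> = measure m {x. q x > 0} - measure m {x. q x < 0}"
    using meas by (subst Bochner_Integration.integral_diff) (auto simp: sp emeasure_eq_measure)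
  finally have eq: "measure m {x. q x > 0} = measure m {x. q x < 0}" using zero by simp
  have U: "UNIV = {x. q x > 0} \<union> ({x. q x < 0} \<union> {x. q x = 0})" by auto
  have "measure m UNIV = measure m {x. q x > 0} + measure m ({x. q x < 0} \<union> {x. q x = 0})"
    by (subst U, rule finite_measure_Union) (use meas in auto)
  also have "measure m ({x. q x < 0} \<union> {x. q x = 0}) = measure m {x. q x < 0} + measure m {x. q x = 0}"
    by (rule finite_measure_Union) (use meas in auto)
  also have "measure m {x. q x = 0} = 0" using null by (simp add: measure_def)
  finally show "measure m {x. q x < 0} = measure m UNIV / 2" "measure m {x. q x > 0} = measure m UNIV / 2"
    using eq by auto
qed

text \<open>For c > 0, completing the square gives a ball around -w / (2c), or a function without
  negative values if the squared radius is not positive. For c = 0 there remains a half-space or a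
  nonzero constant. Negation handles c < 0.\<close>

lemma sphere_region_of_quad:
  fixes L :: "(real^'n) set"
  assumes L: "subspace L" and w: "w \<in> L" and nz: "w \<noteq> 0 \<or> b \<noteq> 0 \<or> c \<noteq> 0"
  shows "L \<inter> {x. quad w b c x \<le> 0} \<in> sphere_regions L \<or> L \<inter> {x. quad w b c x \<ge> 0} \<in> sphere_regions L \<or>
    {x. quad w b c x < 0} = {} \<or> {x. quad w b c x > 0} = {}"
proof -
  have *: "L \<inter> {x. quad w b c x \<le> 0} \<in> sphere_regions L \<or> {x. quad w b c x < 0} = {} \<or> {x. quad w b c x > 0} = {}"
    if c: "0 \<le> c" and w: "w \<in> L" and nz: "w \<noteq> 0 \<or> b \<noteq> 0 \<or> c \<noteq> 0" for w b c
  proof (cases "c = 0")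
    case False
    then have c: "c > 0" using c by simp
    define z where "z = - (inverse (2 * c)) *\<^sub>R w"
    define \<rho> where "\<rho> = z \<bullet> z - b / c"
    have zL: "z \<in> L" unfolding z_def by (intro subspace_scale[OF L] w)
    have wz: "w = - (2 * c) *\<^sub>R z" using c by (simp add: z_def)
    have q: "quad w b c x = c * ((norm (z - x))\<^sup>2 - \<rho>)" for x
    proof -
      have "(norm (z - x))\<^sup>2 = z \<bullet> z - 2 * (z \<bullet> x) + x \<bullet> x"
        by (simp add: power2_norm_eq_inner inner_diff_left inner_diff_right inner_commute)
      then have "c * ((norm (z - x))\<^sup>2 - \<rho>) = c * (x \<bullet> x - 2 * (z \<bullet> x) + b / c)"
        by (simp add: \<rho>_def)
      also have "\<dots> = c * (x \<bullet> x) - 2 * c * (z \<bullet> x) + b" using c by (simp add: field_simps)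
      finally show ?thesis by (simp add: wz quad_def)
    qed
    show ?thesis
    proof (cases "\<rho> > 0")
      case True
      have le: "quad w b c x \<le> 0 \<longleftrightarrow> x \<in> cball z (sqrt \<rho>)" for x
      proof -
        have "quad w b c x \<le> 0 \<longleftrightarrow> (norm (z - x))\<^sup>2 \<le> \<rho>" using c by (simp add: q mult_le_0_iff)
        also have "\<dots> \<longleftrightarrow> (norm (z - x))\<^sup>2 \<le> (sqrt \<rho>)\<^sup>2" using True by simp
        also have "\<dots> \<longleftrightarrow> norm (z - x) \<le> sqrt \<rho>"
          by (rule power_mono_iff) (use True in auto)
        finally show ?thesis by (simp only: mem_cball dist_norm)
      qed
      have "L \<inter> {x. quad w b c x \<le> 0} = L \<inter> cball z (sqrt \<rho>)"
        by (intro set_eqI) (simp only: Int_iff mem_Collect_eq le)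
      moreover have "L \<inter> cball z (sqrt \<rho>) \<in> sphere_regions L"
        unfolding sphere_regions_def
        by (intro UnI1 CollectI exI[of _ z] exI[of _ "sqrt \<rho>"]) (simp add: zL True)
      ultimately show ?thesis by simp
    next
      case False
      have "quad w b c x \<ge> 0" for x
      proof -
        have "(norm (z - x))\<^sup>2 - \<rho> \<ge> 0" using False zero_le_power2[of "norm (z - x)"] by linarith
        then show ?thesis unfolding q using c by (intro mult_nonneg_nonneg) auto
      qed
      then have "{x. quad w b c x < 0} = {}" by (simp add: not_less)
      then show ?thesis by blast
    qed
  next
    case True
    show ?thesis
    proof (cases "w = 0")
      case True
      then show ?thesis using \<open>c = 0\<close> nz by (auto simp: quad_def)
    next
      case False
      have "L \<inter> {x. quad w b c x \<le> 0} = {x \<in> L. w \<bullet> x \<le> - b}" using True by (auto simp: quad_def)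
      moreover have "{x \<in> L. w \<bullet> x \<le> - b} \<in> sphere_regions L"
        unfolding sphere_regions_def
        by (intro UnI2 CollectI exI[of _ w] exI[of _ "- b"]) (simp add: w False)
      ultimately show ?thesis by simp
    qed
  qed
  show ?thesis
  proof (cases "0 \<le> c")
    case False
    have "- w \<in> L" using w L by (simp add: subspace_neg)
    from *[of "- c" "- w" "- b", OF _ this] False nz show ?thesis by (auto simp: quad_minus)
  qed (use * w nz in blast)
qed

lemma measure_halving_region:
  fixes q :: "'a::topological_space \<Rightarrow> real"
  assumes m: "finite_measure m" "sets m = sets borel" and q [measurable]: "q \<in> borel_measurable borel"
    and L: "L \<in> sets borel" "emeasure m (- L) = 0"
    and null: "emeasure m {x. q x = 0} = 0" and zero: "(\<integral>x. sgn (q x) \<partial>m) = 0"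
  shows "measure m (L \<inter> {x. q x \<le> 0}) = measure m UNIV / 2" "measure m (L \<inter> {x. q x \<ge> 0}) = measure m UNIV / 2"
proof -
  have "{x \<in> space borel. q x < 0} \<in> sets borel" "{x \<in> space borel. q x > 0} \<in> sets borel"
    "{x \<in> space borel. q x \<le> 0} \<in> sets borel" "{x \<in> space borel. q x \<ge> 0} \<in> sets borel"
    "{x \<in> space borel. q x = 0} \<in> sets borel"
    by measurable
  then have sets: "{x. q x < 0} \<in> sets m" "{x. q x > 0} \<in> sets m" "L \<inter> {x. q x \<le> 0} \<in> sets m"
    "L \<inter> {x. q x \<ge> 0} \<in> sets m" "{x. q x = 0} \<in> sets m" "- L \<in> sets m"
    using L(1) m(2) by auto
  have "{x. q x = 0} \<in> null_sets m" "- L \<in> null_sets m"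
    using null L(2) sets by (simp_all add: null_sets_def)
  then have "AE x in m. x \<notin> {x. q x = 0}" "AE x in m. x \<notin> - L"
    using AE_not_in by blast+
  then have ae: "AE x in m. (x \<in> L \<inter> {x. q x \<le> 0} \<longleftrightarrow> x \<in> {x. q x < 0}) \<and> (x \<in> L \<inter> {x. q x \<ge> 0} \<longleftrightarrow> x \<in> {x. q x > 0})"
    by eventually_elim auto
  have "measure m (L \<inter> {x. q x \<le> 0}) = measure m {x. q x < 0}"
    "measure m (L \<inter> {x. q x \<ge> 0}) = measure m {x. q x > 0}"
    by (rule finite_measure.finite_measure_eq_AE[OF m(1)]; (use ae in \<open>auto elim: eventually_mono\<close>)?; use sets in simp)+
  then show "measure m (L \<inter> {x. q x \<le> 0}) = measure m UNIV / 2" "measure m (L \<inter> {x. q x \<ge> 0}) = measure m UNIV / 2"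
    using halving_of_integral_sgn[OF m q null zero] by simp_all
qed

section \<open>Bisecting mass assignments by spheres\<close>

text \<open>\<open>T\<close> is chosen first, inside the orthogonal complement of \<open>A\<close>,
  which is large enough because \<open>A\<close> spans at most k - 1 dimensions. The complement
  \<open>V\<close> of \<open>T\<close> then contains \<open>A\<close> and has the exact dimension
  even if the vectors are dependent.\<close>

lemma subspace_pair_containing:
  fixes A :: "'a::euclidean_space set"
  assumes A: "finite A" "card A < k" and k: "k \<le> DIM('a)"
  shows "\<exists>T V. subspace T \<and> subspace V \<and> dim T = Suc (DIM('a) - k) \<and> dim V = k - 1 \<and> A \<subseteq> V \<and>
    (\<forall>x\<in>T. \<forall>y\<in>V. x \<bullet> y = 0)"
proof -
  have dimA: "dim (span A) \<le> k - 1"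
    using dim_le_card'[OF A(1)] A(2) by simp
  define W where "W = {y. \<forall>x\<in>span A. orthogonal x y}"
  have W: "subspace W" unfolding W_def by (rule subspace_orthogonal_to_vectors)
  have "dim W + dim (span A) = DIM('a)"
    using dim_subspace_orthogonal_to_vectors[of "span A" UNIV] by (simp add: W_def)
  then have "Suc (DIM('a) - k) \<le> dim W" using dimA A(2) k by linarith
  then obtain T where T: "subspace T" "T \<subseteq> span W" "dim T = Suc (DIM('a) - k)"
    by (rule choose_subspace_of_subspace)
  have TW: "T \<subseteq> W" using T(2) W by (metis span_eq_iff)
  define V where "V = {y. \<forall>x\<in>T. orthogonal x y}"
  have "subspace V" unfolding V_def by (rule subspace_orthogonal_to_vectors)
  moreover have "dim V + dim T = DIM('a)"
    using dim_subspace_orthogonal_to_vectors[OF T(1) subspace_UNIV] by (simp add: V_def)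
  then have "dim V = k - 1" using T(3) k A(2) by linarith
  moreover have "A \<subseteq> V"
  proof
    fix x assume "x \<in> A"
    then have "orthogonal x y" if "y \<in> T" for y
      using TW that span_base[of x A] by (auto simp: W_def)
    then show "x \<in> V" by (simp add: V_def orthogonal_commute)
  qed
  ultimately show ?thesis using T by (intro exI[of _ T] exI[of _ V]) (auto simp: V_def orthogonal_def)
qed

theorem theorem1p2:
  fixes u :: "nat \<Rightarrow> real^'n"
    and \<mu> :: "nat \<Rightarrow> (real^'n) set \<Rightarrow> (real^'n) measure"
  assumes "CARD('k::finite) \<le> CARD('n)"
    and "\<And>i. i \<le> CARD('n) \<Longrightarrow> mass_assignment TYPE('k) (\<mu> i)"
  shows "\<exists>L \<in> grassmannian CARD('k). (\<forall>i\<in>{1..<CARD('k)}. u i \<in> L) \<and>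
           (\<exists>B \<in> sphere_regions L. \<forall>i \<le> CARD('n).
              measure (\<mu> i L) B = measure (\<mu> i L) UNIV / 2)"
proof -
  define k where "k = CARD('k)"
  define d where "d = CARD('n)"
  define a where "a = Suc (d - k)"
  \<comment> \<open>There are a coordinates for v, d - a = k - 1 for y, and two for b and c. Thus D
    - 1 = d + 1, the number of masses.\<close>
  define D where "D = Suc (Suc d)"
  have k: "0 < k" "k \<le> d" using assms(1) by (auto simp: k_def d_def)
  have a: "0 < a" "a \<le> D" "a \<le> d" using k by (auto simp: a_def D_def)
  have "card (u ` {1..<k}) < k" using k(1) by (intro le_less_trans[OF card_image_le]) auto
  then obtain T V where T: "subspace T" "dim T = a" and V: "subspace V" "dim V = k - 1" "u ` {1..<k} \<subseteq> V"
    and TV: "\<And>x y. x \<in> T \<Longrightarrow> y \<in> V \<Longrightarrow> x \<bullet> y = 0"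
    using subspace_pair_containing[of "u ` {1..<k}" k] k(2) unfolding a_def d_def by auto
  obtain e where e: "\<And>i. i < a \<Longrightarrow> e i \<in> T" "\<And>i j. i < a \<Longrightarrow> j < a \<Longrightarrow> e i \<bullet> e j = of_bool (i = j)"
    using orthonormal_enumeration[OF T(1), of "{..<a}"] T(2) by auto
  have "card {a..<d} = dim V" using V(2) k by (simp add: a_def)
  then obtain f where f: "\<And>i. i \<in> {a..<d} \<Longrightarrow> f i \<in> V"
    "\<And>i j. i \<in> {a..<d} \<Longrightarrow> j \<in> {a..<d} \<Longrightarrow> f i \<bullet> f j = of_bool (i = j)"
    using orthonormal_enumeration[OF V(1), of "{a..<d}"] by blast
  define v where "v p = (\<Sum>i<a. p i *\<^sub>R e i)" for p :: "nat \<Rightarrow> real"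
  define y where "y p = (\<Sum>i\<in>{a..<d}. p i *\<^sub>R f i)" for p :: "nat \<Rightarrow> real"
  \<comment> \<open>Equal to 1 at the centre of the cube, where w must not vanish, and 0 on its
    boundary, where w must not depend on v.\<close>
  define s where "s p = (\<Prod>i\<in>{a..<D}. 1 - \<bar>p i\<bar>)" for p :: "nat \<Rightarrow> real"
  define w where "w p = s p *\<^sub>R v p + y p" for p
  define L where "L p = span (insert (v p) V)" for p
  define q where "q p = quad (w p) (p d) (p (Suc d))" for p :: "nat \<Rightarrow> real"
  define F where "F r p = (\<integral>x. sgn (q p x) \<partial>\<mu> r (L p))" for r p
  let ?K = "sphere_cube D a"
  have v_orth: "v p \<bullet> x = 0" if "x \<in> V" for p x
    unfolding v_def using e(1) TV that by (simp add: inner_sum_left)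
  have v_coord: "v p \<bullet> e j = p j" if "j < a" for p j
  proof -
    have "v p \<bullet> e j = (\<Sum>i<a. if i = j then p i else 0)"
      unfolding v_def inner_sum_left by (intro sum.cong refl) (use e(2) that in auto)
    then show ?thesis using that by simp
  qed
  have yV: "y p \<in> V" for p
    unfolding y_def by (intro subspace_sum[OF V(1)] subspace_scale[OF V(1)] f(1))
  have y_coord: "y p \<bullet> f j = p j" if "j \<in> {a..<d}" for p j
  proof -
    have "y p \<bullet> f j = (\<Sum>i\<in>{a..<d}. if i = j then p i else 0)"
      unfolding y_def inner_sum_left by (intro sum.cong refl) (use f(2) that in auto)
    then show ?thesis using that by simp
  qed
  have v_nz: "v p \<noteq> 0" if p: "p \<in> ?K" for p
  proof -
    obtain i where i: "i < a" "\<bar>p i\<bar> = 1" using p by (auto simp: sphere_cube_def)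
    then show ?thesis using v_coord[OF i(1), of p] by auto
  qed
  have L_gr: "L p \<in> grassmannian CARD('k)" if "p \<in> ?K" for p
  proof -
    have "v p \<notin> span V"
    proof
      assume "v p \<in> span V"
      then have "v p \<in> V" using V(1) by (metis span_eq_iff)
      then show False using v_orth[of "v p" p] v_nz[OF that] by simp
    qed
    then have "dim (insert (v p) V) = k" using V(2) k(1) by (simp add: dim_insert)
    then show ?thesis by (simp add: grassmannian_def L_def k_def)
  qed
  have wL: "w p \<in> L p" for p
    unfolding w_def L_def by (intro span_add span_scale) (auto intro: span_base yV)
  \<comment> \<open>A nonzero coordinate of y survives in w because v is orthogonal to V; if all
    cube coordinates vanish, then w = v.\<close>
  have nz: "w p \<noteq> 0 \<or> p d \<noteq> 0 \<or> p (Suc d) \<noteq> 0" if p: "p \<in> ?K" for p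
  proof (cases "\<exists>i\<in>{a..<d}. p i \<noteq> 0")
    case True
    then obtain i where i: "i \<in> {a..<d}" "p i \<noteq> 0" by blast
    have "w p \<bullet> f i = p i" using y_coord[OF i(1)] v_orth[OF f(1)[OF i(1)]] by (simp add: w_def inner_add_left)
    then show ?thesis using i(2) by auto
  next
    case False
    show ?thesis
    proof (cases "p d = 0 \<and> p (Suc d) = 0")
      case True
      have "p i = 0" if "i \<in> {a..<D}" for i
        using that True False by (cases "i < d") (auto simp: D_def less_Suc_eq)
      then have "s p = 1" unfolding s_def by simp
      moreover have "y p = 0" unfolding y_def using False by simp
      ultimately show ?thesis using v_nz[OF p] by (simp add: w_def)
    qed auto
  qed
  have mass: "mass_distribution_on TYPE('k) (L p) (\<mu> r (L p))" if "r \<le> d" "p \<in> ?K" for r p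
    using assms(2)[of r] that L_gr[OF that(2)] by (simp add: mass_assignment_def d_def)
  have fin: "finite_measure (\<mu> r (L p))" "sets (\<mu> r (L p)) = sets borel" if "r \<le> d" "p \<in> ?K" for r p
    using mass[OF that] by (auto simp: mass_distribution_on_def)
  have null: "emeasure (\<mu> r (L p)) {x. q p x = 0} = 0" if "r \<le> d" "p \<in> ?K" for r p
    unfolding q_def by (rule mass_distribution_on_quad_null[OF mass[OF that] L_gr[OF that(2)] wL nz[OF that(2)]])
  have coord: "(\<lambda>n. p n i) \<longlonglongrightarrow> P i" if "p \<longlonglongrightarrow> P" for p and P :: "nat \<Rightarrow> real" and i
    using that by (rule tendsto_fun_coordinate)
  \<comment> \<open>Integrand and measure both vary with p; the masses converge weakly because
    \<open>L p\<close> moves continuously in the Grassmannian.\<close>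
  have "continuous_on ?K (F r)" if r: "r < D - 1" for r
    unfolding continuous_on_sequentially
  proof (intro allI ballI impI, elim conjE)
    fix p P assume P: "P \<in> ?K" and p: "\<forall>n. p n \<in> ?K" and lim: "p \<longlonglongrightarrow> P"
    have rd: "r \<le> d" using r by (simp add: D_def)
    have v_lim: "(\<lambda>n. v (p n)) \<longlonglongrightarrow> v P"
      unfolding v_def by (intro tendsto_intros coord[OF lim])
    have w_lim: "(\<lambda>n. w (p n)) \<longlonglongrightarrow> w P"
      unfolding w_def s_def y_def by (intro tendsto_intros coord[OF lim] v_lim)
    have "(\<lambda>n. \<integral>x. sgn (q (p n) x) \<partial>\<mu> r (L (p n))) \<longlonglongrightarrow> (\<integral>x. sgn (q P x) \<partial>\<mu> r (L P))"
    proof (rule tendsto_integral_sgn)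
      show "finite_measure (\<mu> r (L P))" "sets (\<mu> r (L P)) = sets borel" using fin[OF rd P] by auto
      show "finite_measure (\<mu> r (L (p n)))" "sets (\<mu> r (L (p n))) = sets borel" for n using fin[OF rd] p by auto
      show "continuous_on UNIV (q P)" "continuous_on UNIV (q (p n))" for n
        unfolding q_def by (intro continuous_intros)+
      show "emeasure (\<mu> r (L P)) {x. q P x = 0} = 0" by (rule null[OF rd P])
      show "\<forall>\<^sub>F n in sequentially. \<forall>x. norm x \<le> R \<longrightarrow> \<bar>q (p n) x - q P x\<bar> < \<epsilon>" if "\<epsilon> > 0" for R \<epsilon>
        unfolding q_def by (intro quad_tendsto_uniform_on_balls w_lim coord[OF lim] that)
      fix h :: "real^'n \<Rightarrow> real" assume h: "continuous_on UNIV h" "bounded (range h)"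
      show "(\<lambda>n. integral\<^sup>L (\<mu> r (L (p n))) h) \<longlonglongrightarrow> integral\<^sup>L (\<mu> r (L P)) h"
      proof (rule tendstoI)
        fix \<epsilon> :: real assume \<epsilon>: "\<epsilon> > 0"
        have "mass_assignment TYPE('k) (\<mu> r)" using assms(2) rd by (simp add: d_def)
        then obtain \<delta> where \<delta>: "\<delta> > 0" "\<And>M. M \<in> grassmannian CARD('k) \<Longrightarrow> gr_dist M (L P) < \<delta> \<Longrightarrow>
            \<bar>integral\<^sup>L (\<mu> r M) h - integral\<^sup>L (\<mu> r (L P)) h\<bar> < \<epsilon>"
          unfolding mass_assignment_def using h L_gr[OF P] \<epsilon> by blast
        have "\<forall>\<^sub>F n in sequentially. gr_dist (L (p n)) (L P) < \<delta>"
          unfolding L_def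
          by (rule gr_dist_span_insert_tendsto[OF V(1) v_orth v_orth v_nz[OF P] _ v_lim \<delta>(1)]) (use p v_nz in auto)
        then show "\<forall>\<^sub>F n in sequentially. dist (integral\<^sup>L (\<mu> r (L (p n))) h) (integral\<^sup>L (\<mu> r (L P)) h) < \<epsilon>"
          by eventually_elim (use \<delta>(2) p L_gr in \<open>auto simp: dist_real_def\<close>)
      qed
    qed
    then show "(F r \<circ> p) \<longlonglongrightarrow> F r P" by (simp add: F_def o_def)
  qed
  \<comment> \<open>The antipode preserves s and the line through v, hence the subspace, and
    reverses w, b and c.\<close>
  moreover have "F r (\<lambda>i. - p i) = - F r p" for r p
  proof -
    have v: "v (\<lambda>i. - p i) = - v p" and y: "y (\<lambda>i. - p i) = - y p"
      by (simp_all add: v_def y_def sum_negf)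
    have "w (\<lambda>i. - p i) = - w p" by (simp add: w_def v y s_def)
    then have "q (\<lambda>i. - p i) x = - q p x" for x by (simp add: q_def quad_minus)
    moreover have "L (\<lambda>i. - p i) = L p"
      unfolding L_def v using span_insert_scale[of "-1" "v p" V] by simp
    ultimately show ?thesis by (simp add: F_def sgn_minus)
  qed
  \<comment> \<open>Here s vanishes, so v enters only through the line it spans. The coordinates d
    and d + 1 lie outside the reflected range because \<open>a \<le> d\<close>.\<close>
  moreover have "F r (\<lambda>i. if i < a then - p i else p i) = F r p" if l: "\<exists>l\<in>{a..<D}. \<bar>p l\<bar> = 1" for r p
  proof -
    let ?p = "\<lambda>i. if i < a then - p i else p i"
    have v: "v ?p = - v p" by (simp add: v_def sum_negf)
    have y: "y ?p = y p" unfolding y_def by (intro sum.cong refl) auto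
    have "s p = 0" "s ?p = 0" unfolding s_def using l by (auto intro!: prod_zero)
    then have "w ?p = w p" by (simp add: w_def y)
    then have "q ?p = q p" using a(3) by (simp add: q_def)
    moreover have "L ?p = L p"
      unfolding L_def v using span_insert_scale[of "-1" "v p" V] by simp
    ultimately show ?thesis by (simp add: F_def)
  qed
  ultimately obtain p where p: "p \<in> ?K" and "\<forall>r<D-1. F r p = 0"
    using common_zero_sphere_cube[OF a(1,2), of F] by blast
  then have zero: "(\<integral>x. sgn (q p x) \<partial>\<mu> r (L p)) = 0" if "r \<le> d" for r
    using that by (simp add: F_def D_def)
  have Lsub: "subspace (L p)" by (simp add: L_def)
  have L_borel: "L p \<in> sets borel" using closed_subspace[OF Lsub] by auto
  have compl: "emeasure (\<mu> r (L p)) (- L p) = 0" if "r \<le> d" for r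
    by (rule mass_distribution_on_complement_null[OF mass[OF that p] L_gr[OF p]])
  have q_meas: "q p \<in> borel_measurable borel" unfolding q_def by simp
  note half = measure_halving_region[OF fin[OF _ p] q_meas L_borel compl null[OF _ p] zero]
  note sides = halving_of_integral_sgn[OF fin[OF _ p] q_meas null[OF _ p] zero]
  have "\<exists>B\<in>sphere_regions (L p). \<forall>r\<le>d. measure (\<mu> r (L p)) B = measure (\<mu> r (L p)) UNIV / 2"
    using sphere_region_of_quad[OF Lsub wL nz[OF p], folded q_def]
  proof (elim disjE)
    assume "L p \<inter> {x. q p x \<le> 0} \<in> sphere_regions (L p)"
    then show ?thesis using half(1) by blast
  next
    assume "L p \<inter> {x. q p x \<ge> 0} \<in> sphere_regions (L p)"
    then show ?thesis using half(2) by blast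
  next
    \<comment> \<open>An empty open side carries half of each mass, so in the last two cases all
      masses vanish and any ball will do.\<close>
    have degenerate: ?thesis if z: "\<And>r. r \<le> d \<Longrightarrow> measure (\<mu> r (L p)) UNIV = 0"
    proof -
      have "L p \<inter> cball 0 1 \<in> sphere_regions (L p)"
        unfolding sphere_regions_def using subspace_0[OF Lsub]
        by (intro UnI1 CollectI exI[of _ 0] exI[of _ 1]) simp
      moreover have "measure (\<mu> r (L p)) (L p \<inter> cball 0 1) = 0" if "r \<le> d" for r
        using finite_measure.bounded_measure[OF fin(1)[OF that p], of "L p \<inter> cball 0 1"]
          sets_eq_imp_space_eq[OF fin(2)[OF that p]] z[OF that] by (simp add: measure_le_0_iff)
      ultimately show ?thesis using z by (intro bexI[of _ "L p \<inter> cball 0 1"]) auto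
    qed
    {
      assume "{x. q p x < 0} = {}"
      then show ?thesis using degenerate sides(1) by simp
    next
      assume "{x. q p x > 0} = {}"
      then show ?thesis using degenerate sides(2) by simp
    }
  qed
  moreover have "u i \<in> L p" if "i \<in> {1..<CARD('k)}" for i
  proof -
    have "u i \<in> V" using V(3) that unfolding k_def by blast
    then show ?thesis unfolding L_def by (intro span_base) simp
  qed
  ultimately show ?thesis using L_gr[OF p] unfolding d_def by blast
qed

end
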